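(* For every integer $r\ge 3$ there is an integer $f(r)$ such that every $2$-edge-connected graph of order at least $f(r)$ has: (a) a subgraph that is an $r$-flower, a cycle of order at least $r$, a chain of $r$ cycles, or a member of $\mathscr{K}_{2,r}$; and (b) a topological minor (and hence a minor) that is a triangular $r$-flower, $C_r$, a chain of $r$ triangles, or $K_{2,r}$.
   Context: Graphs are finite and simple. An $r$-flower consists of $r$ edge-disjoint induced cycles pairwise meeting only in one common vertex; it is triangular if every cycle is a triangle. A chain of $n$ blocks is a graph with exactly $n$ blocks whose block-cutvertex tree is a path; a chain of $n$ cycles (triangles) is such a chain in which every block is a cycle (triangle). $\mathscr{K}_{2,r}$ is the family of all subdivisions of $K_{2,r}$. *)

theory Defs
  imports "Graph_Theory.Graph_Theory"
begin

text \<open>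
  A finite simple graph is a \<^const>\<open>pair_graph\<close>: a finite, loopless, symmetric set of arcs, each
  undirected edge being represented by its two orientations. Neither \<^const>\<open>subgraph\<close> nor
  \<^const>\<open>induced_subgraph\<close> demands symmetry of the smaller graph; wherever they are used below it
  is known to be a graph by some other conjunct.
\<close>

subsection \<open>Edge-connectivity\<close>

definition edges :: "'a pair_pre_digraph \<Rightarrow> 'a set set" where
  "edges G = (\<lambda>(u, v). {u, v}) ` parcs G"

definition del_edges :: "'a pair_pre_digraph \<Rightarrow> 'a set set \<Rightarrow> 'a pair_pre_digraph" where
  "del_edges G F = \<lparr>pverts = pverts G, parcs = {(u, v) \<in> parcs G. {u, v} \<notin> F}\<rparr>"

definition edge_connected :: "nat \<Rightarrow> 'a pair_pre_digraph \<Rightarrow> bool" where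
  "edge_connected k G \<longleftrightarrow> pair_graph G \<and> card (pverts G) > 1 \<and>
     (\<forall>F \<subseteq> edges G. card F < k \<longrightarrow> Digraph_Component.connected (with_proj (del_edges G F)))"

subsection \<open>Paths, cycles and flowers\<close>

definition path_graph :: "'a pair_pre_digraph \<Rightarrow> bool" where
  "path_graph P \<longleftrightarrow> (\<exists>vs. vs \<noteq> [] \<and> distinct vs \<and>
     pverts P = set vs \<and> parcs P = symcl (set (vwalk_arcs vs)))"

definition cycle_graph :: "'a pair_pre_digraph \<Rightarrow> bool" where
  "cycle_graph C \<longleftrightarrow> (\<exists>vs. length vs \<ge> 3 \<and> distinct vs \<and>
     pverts C = set vs \<and> parcs C = symcl (set (vwalk_arcs (vs @ [hd vs]))))"

definition triangle_graph :: "'a pair_pre_digraph \<Rightarrow> bool" where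
  "triangle_graph C \<longleftrightarrow> cycle_graph C \<and> card (pverts C) = 3"

text \<open>The cycles of a flower are induced subgraphs of the flower itself.\<close>

definition flower_cycles :: "nat \<Rightarrow> 'a pair_pre_digraph \<Rightarrow> 'a pair_pre_digraph set \<Rightarrow> bool" where
  "flower_cycles r F \<C> \<longleftrightarrow> finite \<C> \<and> card \<C> = r \<and>
     (\<forall>C\<in>\<C>. cycle_graph C \<and> induced_subgraph (with_proj C) (with_proj F)) \<and>
     pverts F = (\<Union>C\<in>\<C>. pverts C) \<and> parcs F = (\<Union>C\<in>\<C>. parcs C) \<and>
     (\<forall>C\<in>\<C>. \<forall>D\<in>\<C>. C \<noteq> D \<longrightarrow> edges C \<inter> edges D = {}) \<and>
     (\<exists>v. \<forall>C\<in>\<C>. \<forall>D\<in>\<C>. C \<noteq> D \<longrightarrow> pverts C \<inter> pverts D = {v})"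

definition flower :: "nat \<Rightarrow> 'a pair_pre_digraph \<Rightarrow> bool" where
  "flower r F \<longleftrightarrow> (\<exists>\<C>. flower_cycles r F \<C>)"

definition triangular_flower :: "nat \<Rightarrow> 'a pair_pre_digraph \<Rightarrow> bool" where
  "triangular_flower r F \<longleftrightarrow> (\<exists>\<C>. flower_cycles r F \<C> \<and> (\<forall>C\<in>\<C>. triangle_graph C))"

subsection \<open>Blocks and chains\<close>

text \<open>A cutvertex separates two other vertices of the same component.\<close>

definition cutvertex :: "('a, 'b) pre_digraph \<Rightarrow> 'a \<Rightarrow> bool" where
  "cutvertex G v \<longleftrightarrow> v \<in> verts G \<and>
     (\<exists>x\<in>verts G - {v}. \<exists>y\<in>verts G - {v}.
        x \<rightarrow>\<^sup>*\<^bsub>G\<^esub> y \<and> \<not> x \<rightarrow>\<^sup>*\<^bsub>pre_digraph.del_vert G v\<^esub> y)"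

definition block :: "'a pair_pre_digraph \<Rightarrow> 'a pair_pre_digraph \<Rightarrow> bool" where
  "block G B \<longleftrightarrow> pre_digraph.max_subgraph (with_proj G)
     (\<lambda>H. graph H \<and> Digraph_Component.connected H \<and> \<not> (\<exists>v. cutvertex H v)) (with_proj B)"

definition block_cutvertex_graph ::
    "'a pair_pre_digraph \<Rightarrow> ('a pair_pre_digraph + 'a) pair_pre_digraph" where
  "block_cutvertex_graph G =
     \<lparr>pverts = Inl ` {B. block G B} \<union> Inr ` {v. cutvertex (with_proj G) v},
      parcs = symcl {(Inl B, Inr v) | B v. block G B \<and> cutvertex (with_proj G) v \<and> v \<in> pverts B}\<rparr>"

definition chain_of_blocks :: "nat \<Rightarrow> 'a pair_pre_digraph \<Rightarrow> bool" where
  "chain_of_blocks n G \<longleftrightarrow> pair_graph G \<and> card {B. block G B} = n \<and>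
     path_graph (block_cutvertex_graph G)"

definition chain_of_cycles :: "nat \<Rightarrow> 'a pair_pre_digraph \<Rightarrow> bool" where
  "chain_of_cycles n G \<longleftrightarrow> chain_of_blocks n G \<and> (\<forall>B. block G B \<longrightarrow> cycle_graph B)"

definition chain_of_triangles :: "nat \<Rightarrow> 'a pair_pre_digraph \<Rightarrow> bool" where
  "chain_of_triangles n G \<longleftrightarrow> chain_of_blocks n G \<and> (\<forall>B. block G B \<longrightarrow> triangle_graph B)"

subsection \<open>Subdivisions and minors\<close>

definition K2_subdivision :: "nat \<Rightarrow> 'a pair_pre_digraph \<Rightarrow> bool" where
  "K2_subdivision r H \<longleftrightarrow> (\<exists>K. K\<^bsub>2,r\<^esub> (with_proj K) \<and> subdivision_pair K H)"

text \<open>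
  The library's subdivision relation keeps the original vertices, so an arbitrary graph is first
  replaced by an isomorphic copy \<open>Y\<close> on the vertices of \<open>G\<close>.
\<close>

definition topological_minor :: "'b pair_pre_digraph \<Rightarrow> 'a pair_pre_digraph \<Rightarrow> bool" where
  "topological_minor X G \<longleftrightarrow> (\<exists>Y H. digraph_iso (with_proj X) (with_proj Y) \<and>
     subdivision_pair Y H \<and> subgraph (with_proj H) (with_proj G))"

text \<open>\<open>\<beta>\<close> assigns to each vertex of the minor its branch set.\<close>

definition minor :: "'b pair_pre_digraph \<Rightarrow> 'a pair_pre_digraph \<Rightarrow> bool" where
  "minor X G \<longleftrightarrow> (\<exists>\<beta> :: 'b \<Rightarrow> 'a set.
     (\<forall>x\<in>pverts X. \<beta> x \<subseteq> pverts G \<and> Digraph_Component.connected (with_proj G \<restriction> \<beta> x)) \<and>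
     (\<forall>x\<in>pverts X. \<forall>y\<in>pverts X. x \<noteq> y \<longrightarrow> \<beta> x \<inter> \<beta> y = {}) \<and>
     (\<forall>(x, y)\<in>parcs X. \<exists>u\<in>\<beta> x. \<exists>v\<in>\<beta> y. (u, v) \<in> parcs G))"

end

theory Submission
  imports Defs
begin

text \<open>
  Any two vertices \<open>x\<close>, \<open>y\<close> of a 2-edge-connected graph are joined by a chain of cycles: moving the end
  of a chain from \<open>a\<close> to a neighbour \<open>y\<close> yields, since \<open>ay\<close> is not a bridge, either a new cycle at
  \<open>a\<close> or an ear that merges the last few cycles into one. So if there is neither a cycle of order
  at least \<open>r\<close> nor a chain of \<open>r\<close> cycles, then the diameter is bounded, and a large graph has a
  vertex \<open>v\<close> of large degree. If many neighbours of \<open>v\<close> lie in pairwise different components of the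
  graph without \<open>v\<close>, then the cycles through the corresponding edges form a flower. Otherwise one
  component contains many neighbours of \<open>v\<close>; paths between these are short, since \<open>v\<close> closes them to
  cycles, and therefore some vertex \<open>u\<close> sends a large fan to them. With \<open>v\<close> this is a subdivision of
  \<open>K\<^bsub>2,r\<^esub>\<close>. The topological minors arise by shortening each cycle or path separately.
\<close>

section \<open>Paths, cycles and chains in symmetric relations\<close>

text \<open>The first half works with a bare relation, so that deleting an edge or a vertex only
  changes the relation. A chain has to end exactly where the walk has arrived, and an ear may land
  on any earlier cycle. Merging cycles is harmless because only the existence of a chain is asserted
  at that stage; the bound on its length comes from the assumption that no long chain exists. The
  vertex of large degree and the fan inside a component come from the same statement: many targets
  within bounded distance of one vertex force a large fan at some vertex. It is applied once to all
  vertices, where only the degree of the centre is used, and once to the neighbours of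
  \<open>v\<close> in one component; the two constants are nested accordingly. Every outcome is
  finally presented as a subgraph \<open>H\<close> together with a graph \<open>X\<close> of which
  it is a subdivision, so that (a) and (b) are obtained from the same pair.\<close>

definition spath :: "'a rel \<Rightarrow> 'a \<Rightarrow> 'a list \<Rightarrow> 'a \<Rightarrow> bool" where
  "spath E a p b \<longleftrightarrow> p \<noteq> [] \<and> hd p = a \<and> last p = b \<and> distinct p \<and> set (vwalk_arcs p) \<subseteq> E"

definition cyc :: "'a rel \<Rightarrow> 'a list \<Rightarrow> bool" where
  "cyc E vs \<longleftrightarrow> 3 \<le> length vs \<and> distinct vs \<and> set (vwalk_arcs (vs @ [hd vs])) \<subseteq> E"

lemma set_vwalk_arcs_append:
  "p \<noteq> [] \<Longrightarrow> q \<noteq> [] \<Longrightarrow>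
    set (vwalk_arcs (p @ q)) = set (vwalk_arcs p) \<union> {(last p, hd q)} \<union> set (vwalk_arcs q)"
  by (simp add: vwalk_arcs_append)

lemma vwalk_arcs_split:
  "vwalk_arcs (xs @ z # ys) = vwalk_arcs (xs @ [z]) @ vwalk_arcs (z # ys)"
proof (induction xs rule: vwalk_arcs.induct)
  case (2 x)
  show ?case by (cases ys) auto
qed (auto simp del: vwalk_arcs_Cons)

lemma set_vwalk_arcs_rev: "set (vwalk_arcs (rev p)) = (set (vwalk_arcs p))\<inverse>"
proof (induction p)
  case (Cons a p)
  then show ?case by (cases "p = []") (auto simp: set_vwalk_arcs_append last_rev)
qed simp

lemma vwalk_arcs_in_set: "(x, y) \<in> set (vwalk_arcs p) \<Longrightarrow> x \<in> set p \<and> y \<in> set p"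
  by (induction p rule: vwalk_arcs.induct) auto

lemma spath_ends_in_set: "spath E a p b \<Longrightarrow> a \<in> set p \<and> b \<in> set p"
  by (auto simp: spath_def)

lemma spath_singleton: "spath E a [a] a"
  by (simp add: spath_def)

lemma spath_mono: "spath E a p b \<Longrightarrow> E \<subseteq> E' \<Longrightarrow> spath E' a p b"
  by (auto simp: spath_def)

lemma spath_Cons: "spath E b p c \<Longrightarrow> (a, b) \<in> E \<Longrightarrow> a \<notin> set p \<Longrightarrow> spath E a (a # p) c"
  by (auto simp: spath_def)

lemma spath_rev: "spath E a p b \<Longrightarrow> sym E \<Longrightarrow> spath E b (rev p) a"
  by (auto simp: spath_def set_vwalk_arcs_rev hd_rev last_rev dest: symD)

lemma spath_append:
  assumes "spath E a p b" "spath E b q c" "set p \<inter> set q = {b}"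
  shows "spath E a (p @ tl q) c" "set (p @ tl q) = set p \<union> set q"
proof -
  obtain q' where q: "q = b # q'" using assms(2) by (cases q) (auto simp: spath_def)
  show "spath E a (p @ tl q) c"
    using assms by (cases "q' = []") (auto simp: q spath_def set_vwalk_arcs_append)
  show "set (p @ tl q) = set p \<union> set q"
    using assms by (auto simp: q spath_def)
qed

lemma spath_prefix:
  assumes "spath E a (xs @ z # ys) b"
  shows "spath E a (xs @ [z]) z"
  using assms unfolding spath_def vwalk_arcs_split[of xs z ys] by (cases xs) auto

lemma spath_suffix:
  assumes "spath E a (xs @ z # ys) b"
  shows "spath E z (z # ys) b"
  using assms unfolding spath_def vwalk_arcs_split[of xs z ys] by (cases xs) auto

lemma spath_first_hit:
  assumes "spath E a p b" "b \<in> S"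
  obtains q z where "spath E a q z" "set q \<inter> S = {z}"
proof -
  have "\<exists>x\<in>set p. x \<in> S" using assms spath_ends_in_set by metis
  from split_list_first_prop[OF this]
  obtain xs z ys where p: "p = xs @ z # ys" "z \<in> S" "\<forall>x\<in>set xs. x \<notin> S"
    by blast
  then show ?thesis using that[of "xs @ [z]" z] spath_prefix assms(1) by fastforce
qed

text \<open>The path is cut at its last vertex in \<open>S\<close>. If this is not the start
  \<open>a\<close>, at least one vertex is lost; the strict drop in length drives the induction on
  distance for fans.\<close>

lemma spath_last_hit:
  assumes "spath E a p b" "a \<in> S"
  obtains q z where "spath E z q b" "set q \<inter> S = {z}" "length q \<le> length p"
    "z = a \<or> length q < length p"
proof -
  have "\<exists>x\<in>set p. x \<in> S" using assms spath_ends_in_set by metis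
  from split_list_last_prop[OF this]
  obtain xs z ys where p: "p = xs @ z # ys" "z \<in> S" "\<forall>x\<in>set ys. x \<notin> S"
    by blast
  moreover have "z = a" if "xs = []" using assms(1) p that by (simp add: spath_def)
  ultimately show ?thesis using that[of z "z # ys"] spath_suffix assms(1) by fastforce
qed

lemma rtrancl_imp_spath:
  assumes "(a, b) \<in> E\<^sup>*"
  obtains p where "spath E a p b"
proof -
  from assms have "\<exists>p. spath E a p b"
  proof (induction rule: converse_rtrancl_induct)
    case base
    show ?case using spath_singleton by fast
  next
    case (step a c)
    then obtain p where p: "spath E c p b" by blast
    show ?case
    proof (cases "a \<in> set p")
      case True
      then obtain xs ys where "p = xs @ a # ys" by (auto dest: split_list)
      then show ?thesis using spath_suffix p by fast
    next
      case False
      then show ?thesis using spath_Cons p step by fast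
    qed
  qed
  then show ?thesis using that by blast
qed

lemma spath_imp_rtrancl:
  assumes "spath E a p b" "x \<in> set p"
  shows "(a, x) \<in> E\<^sup>*"
  using assms
proof (induction p arbitrary: a)
  case (Cons c p)
  show ?case
  proof (cases "x = c")
    case False
    then have "p \<noteq> []" using Cons.prems by auto
    then have "spath E (hd p) p b" "(a, hd p) \<in> E" "x \<in> set p"
      using Cons.prems False by (auto simp: spath_def)
    then show ?thesis using Cons.IH by (meson converse_rtrancl_into_rtrancl)
  qed (use Cons.prems in \<open>auto simp: spath_def\<close>)
qed simp

lemma cycle_rotate:
  assumes "a \<in> set vs"
  obtains ws where "hd ws = a" "ws \<noteq> []" "set ws = set vs" "length ws = length vs"
    "distinct ws \<longleftrightarrow> distinct vs"
    "set (vwalk_arcs (ws @ [hd ws])) = set (vwalk_arcs (vs @ [hd vs]))"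
proof -
  obtain xs ys where vs: "vs = xs @ a # ys" using assms by (auto dest: split_list)
  have "set (vwalk_arcs (((a # ys) @ xs) @ [hd ((a # ys) @ xs)]))
      = set (vwalk_arcs ((xs @ a # ys) @ [hd (xs @ a # ys)]))"
  proof (cases xs)
    case (Cons x xs')
    then show ?thesis
      using vwalk_arcs_split[of "a # ys" x "xs' @ [a]"] vwalk_arcs_split[of xs a "ys @ [x]"]
      by (simp add: Un_commute del: vwalk_arcs_Cons)
  qed simp
  then show ?thesis using that[of "(a # ys) @ xs"] by (auto simp: vs)
qed

text \<open>Rotated to start at \<open>a\<close>, the cycle splits at \<open>b\<close> into two
  arcs; the second, read backwards, also runs from \<open>a\<close> to \<open>b\<close>, and
  \<open>c\<close> lies on one of them. Prescribing \<open>c\<close> lets a chain keep its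
  attachment vertex when a cycle is rerouted.\<close>

lemma cyc_arc:
  assumes "cyc E vs" "sym E" "a \<in> set vs" "b \<in> set vs" "a \<noteq> b" "c \<in> set vs"
  obtains p where "spath E a p b" "set p \<subseteq> set vs" "c \<in> set p"
proof -
  obtain ws where ws: "hd ws = a" "ws \<noteq> []" "set ws = set vs" "length ws = length vs"
    "distinct ws" "set (vwalk_arcs (ws @ [hd ws])) \<subseteq> E"
    using cycle_rotate[OF assms(3)] assms(1) unfolding cyc_def by metis
  from ws(1,2) obtain ws' where "ws = a # ws'" by (cases ws) auto
  moreover from this have "b \<in> set ws'" using assms ws by auto
  ultimately obtain xs ys where w: "ws = (a # xs) @ b # ys" by (auto dest: split_list)
  have arcs: "set (vwalk_arcs (((a # xs) @ b # ys) @ [a])) \<subseteq> E"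
    using ws(6) ws(1) unfolding w by simp
  then have arcs: "set (vwalk_arcs ((a # xs) @ [b])) \<subseteq> E" "set (vwalk_arcs ((b # ys) @ [a])) \<subseteq> E"
    using vwalk_arcs_split[of "a # xs" b "ys @ [a]"] by (simp_all del: vwalk_arcs_Cons)
  have 1: "spath E a ((a # xs) @ [b]) b"
    using ws(5) arcs(1) unfolding w spath_def by simp
  have "spath E b ((b # ys) @ [a]) a"
    using ws(5) arcs(2) unfolding w spath_def by auto
  then have 2: "spath E a (rev ((b # ys) @ [a])) b" using assms(2) by (rule spath_rev)
  have "c \<in> set ((a # xs) @ [b]) \<or> c \<in> set (rev ((b # ys) @ [a]))"
    using assms(6) ws(3) w by auto
  moreover have "set ((a # xs) @ [b]) \<subseteq> set vs" "set (rev ((b # ys) @ [a])) \<subseteq> set vs"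
    using ws(3) w by auto
  ultimately show ?thesis using that 1 2 by blast
qed

text \<open>The bound on \<open>length p\<close> excludes two copies of one edge; \<open>q\<close>
  may be a single edge. The cycle runs along \<open>p\<close> and returns through the interior
  \<open>m\<close> of \<open>q\<close>.\<close>

lemma cyc_join:
  assumes "spath E a p b" "spath E a q b" "set p \<inter> set q = {a, b}" "a \<noteq> b"
    "3 \<le> length p" "sym E"
  obtains vs where "cyc E vs" "set vs = set p \<union> set q"
proof -
  obtain q1 where q1: "q = a # q1" using assms(2) by (cases q) (auto simp: spath_def)
  with assms(2,4) have "q1 \<noteq> []" by (auto simp: spath_def)
  then obtain m where "q1 = m @ [b]" using q1 assms(2) 
    by (metis append_butlast_last_id last_ConsR spath_def)
  with q1 have q: "q = a # m @ [b]" by simp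
  have "distinct q" using assms(2) by (simp add: spath_def)
  have "spath E b (rev q) a" using assms(2,6) by (rule spath_rev)
  then have r: "set (vwalk_arcs ([b] @ rev m @ [a])) \<subseteq> E" by (simp add: q spath_def)
  have p: "p \<noteq> []" "hd p = a" "last p = b" "distinct p" "set (vwalk_arcs p) \<subseteq> E"
    using assms(1) by (auto simp: spath_def)
  have "set (vwalk_arcs ((p @ rev m) @ [hd (p @ rev m)])) \<subseteq> E"
    using r p by (cases "m = []") (auto simp: set_vwalk_arcs_append)
  moreover have "distinct (p @ rev m)"
  proof -
    have "set p \<inter> set m \<subseteq> {a, b}" using assms(3) by (auto simp: q)
    then show ?thesis using p \<open>distinct q\<close> by (auto simp: q)
  qed
  moreover have "set (p @ rev m) = set p \<union> set q"
    using p by (auto simp: q)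
  ultimately show ?thesis using that[of "p @ rev m"] assms(5) unfolding cyc_def by auto
qed

lemma cyc_closed_spath:
  assumes "spath E a p b" "(b, a) \<in> E" "3 \<le> length p"
  shows "cyc E p"
  using assms by (auto simp: cyc_def spath_def set_vwalk_arcs_append)

text \<open>Applied after an edge has been deleted: a path joining its ends in what is left has an
  inner vertex, so the edge closes it to a cycle.\<close>

lemma spath_length_ge_3:
  assumes "spath E a p b" "a \<noteq> b" "(a, b) \<notin> E"
  shows "3 \<le> length p"
proof -
  have "p \<noteq> []" "\<And>x. p \<noteq> [x]" "\<And>x y. p \<noteq> [x, y]"
    using assms by (auto simp: spath_def)
  then show ?thesis by (cases p; cases "tl p"; cases "tl (tl p)") auto
qed

section \<open>Chains of cycles in a bridgeless relation\<close>

abbreviation avoiding :: "'a \<Rightarrow> 'a rel \<Rightarrow> 'a rel" where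
  "avoiding v E \<equiv> {(a, b) \<in> E. a \<noteq> v \<and> b \<noteq> v}"

definition chain_verts :: "'a \<Rightarrow> 'a list list \<Rightarrow> 'a set" where
  "chain_verts x Cs = insert x (\<Union>C\<in>set Cs. set C)"

text \<open>The newest cycle stands at the head of the list. It meets everything before it only in
  the former end \<open>c\<close>, and \<open>y \<noteq> c\<close> keeps the next link off the older
  cycles, so that non-consecutive cycles are disjoint.\<close>

inductive chain :: "'a rel \<Rightarrow> 'a \<Rightarrow> 'a list list \<Rightarrow> 'a \<Rightarrow> bool" for E x where
  Nil: "chain E x [] x"
| Cons: "\<lbrakk>chain E x Cs c; cyc E C; set C \<inter> chain_verts x Cs = {c}; y \<in> set C; y \<noteq> c\<rbrakk>
    \<Longrightarrow> chain E x (C # Cs) y"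

lemma chain_verts_simps [simp]:
  "chain_verts x [] = {x}" "chain_verts x (C # Cs) = set C \<union> chain_verts x Cs"
  by (auto simp: chain_verts_def)

lemma chain_end_in_verts: "chain E x Cs y \<Longrightarrow> y \<in> chain_verts x Cs"
  by (induction rule: chain.induct) auto

text \<open>Newest cycles are discarded while the remaining chain still contains \<open>y\<close>.
  Then \<open>y\<close> is on the last cycle kept and differs from its link, or the chain is empty
  and \<open>y = x\<close>.\<close>

lemma chain_to_member:
  assumes "chain E x Cs a" "y \<in> chain_verts x Cs"
  shows "\<exists>Cs'. chain E x Cs' y"
  using assms
proof (induction rule: chain.induct)
  case Nil
  then show ?case using chain.Nil[of E x] by auto
next
  case (Cons Cs c C a)
  show ?case
  proof (cases "y \<in> chain_verts x Cs")
    case False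
    then have "y \<in> set C" "y \<noteq> c" using Cons by auto
    then show ?thesis using chain.Cons Cons.hyps by meson
  qed (use Cons in blast)
qed

text \<open>An ear from the end of a chain back to the chain swallows the cycles it spans; among the two
  arcs of the cycle where it lands, one keeps the attachment vertex to the rest of the chain.\<close>

lemma chain_ear:
  assumes "chain E x Cs a" "sym E" "spath E a q z" "a \<noteq> z" "set q \<inter> chain_verts x Cs = {a, z}"
    "y \<in> set q" "y \<notin> chain_verts x Cs"
  shows "\<exists>Cs'. chain E x Cs' y"
  using assms
proof (induction arbitrary: q rule: chain.induct)
  case Nil
  then show ?case by auto
next
  case (Cons Cs c C a)
  have C: "set C \<inter> chain_verts x Cs = {c}" "a \<in> set C" "a \<noteq> c" by fact+
  have q: "set q \<inter> (set C \<union> chain_verts x Cs) = {a, z}" "y \<notin> set C" "y \<notin> chain_verts x Cs"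
    using Cons.prems by auto
  show ?case
  proof (cases "z \<in> set C")
    case True
    obtain p where p: "spath E a p z" "set p \<subseteq> set C" "c \<in> set p"
      using cyc_arc[OF \<open>cyc E C\<close> \<open>sym E\<close> \<open>a \<in> set C\<close> True \<open>a \<noteq> z\<close>, of c] C by blast
    \<comment> \<open>The third vertex \<open>y\<close> gives the ear the three vertices that
      \<open>cyc_join\<close> asks for.\<close>
    have "card {a, y, z} \<le> card (set q)"
      using q Cons.prems by (intro card_mono) auto
    moreover have "card {a, y, z} = 3" using q True C \<open>a \<noteq> z\<close> by (auto simp: card_insert_if)
    moreover have "set q \<inter> set p = {a, z}" using q p spath_ends_in_set by fast
    ultimately obtain D where D: "cyc E D" "set D = set q \<union> set p"
      using cyc_join[OF \<open>spath E a q z\<close> p(1)] \<open>a \<noteq> z\<close> \<open>sym E\<close> card_length[of q]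
      by (metis order_trans)
    have "set D \<inter> chain_verts x Cs = {c}" using D q C p True by auto
    then have "chain E x (D # Cs) y"
      using D q C Cons.hyps Cons.prems by (intro chain.Cons) auto
    then show ?thesis by blast
  next
    case False
    \<comment> \<open>\<open>C\<close> is given up: an arc of it lengthens the ear to one starting
      at \<open>c\<close>, the end of the shorter chain, where the induction hypothesis
      applies.\<close>
    obtain p where p: "spath E c p a" "set p \<subseteq> set C"
      using cyc_arc[OF \<open>cyc E C\<close> \<open>sym E\<close>, of c a c] C by blast
    have pq: "set p \<inter> set q = {a}" using p q False spath_ends_in_set[OF p(1)] by auto
    note app = spath_append[OF p(1) \<open>spath E a q z\<close> pq]
    have "set (p @ tl q) \<inter> chain_verts x Cs = {c, z}"
      unfolding app(2) using p q C False spath_ends_in_set[OF p(1)] by auto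
    moreover have "c \<noteq> z" using C False by auto
    moreover have "y \<in> set (p @ tl q)" unfolding app(2) using Cons.prems by auto
    ultimately show ?thesis using Cons.IH app(1) \<open>sym E\<close> q(3) by blast
  qed
qed

definition bridgeless :: "'a rel \<Rightarrow> bool" where
  "bridgeless E \<longleftrightarrow> (\<forall>(a, b)\<in>E. (a, b) \<in> (E - {(a, b), (b, a)})\<^sup>*)"

lemma bridgelessD:
  assumes "bridgeless E" "(a, b) \<in> E"
  obtains p where "spath (E - {(a, b), (b, a)}) a p b"
proof -
  have "(a, b) \<in> (E - {(a, b), (b, a)})\<^sup>*" using assms unfolding bridgeless_def by auto
  then show ?thesis using that by (rule rtrancl_imp_spath)
qed

lemma chain_exists:
  assumes "(x, y) \<in> E\<^sup>*" "sym E" "irrefl E" "bridgeless E"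
  shows "\<exists>Cs. chain E x Cs y"
  using assms(1)
proof (induction rule: rtrancl_induct)
  case base
  then show ?case using chain.Nil by metis
next
  case (step a y)
  then obtain Cs where Cs: "chain E x Cs a" by blast
  show ?case
  proof (cases "y \<in> chain_verts x Cs")
    case True
    then show ?thesis using chain_to_member Cs by fast
  next
    case False
    let ?E = "E - {(y, a), (a, y)}"
    have ya: "(y, a) \<in> E" using step assms by (auto dest: symD)
    then have "a \<noteq> y" using assms by (auto simp: irrefl_def)
    have a: "a \<in> chain_verts x Cs" using Cs by (rule chain_end_in_verts)
    \<comment> \<open>The detour around the edge \<open>ay\<close> is followed from \<open>y\<close>
      until it first meets the chain. At \<open>a\<close> it closes a new cycle; elsewhere the edge
      \<open>ay\<close> completes it to an ear.\<close>
    obtain p where p: "spath ?E y p a" using assms(4) ya by (rule bridgelessD)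
    obtain q z where q: "spath ?E y q z" "set q \<inter> chain_verts x Cs = {z}"
      using p a by (rule spath_first_hit)
    have qE: "spath E y q z" using q(1) by (rule spath_mono) blast
    show ?thesis
    proof (cases "z = a")
      case True
      have "3 \<le> length q"
        using q(1) True \<open>a \<noteq> y\<close> spath_length_ge_3[of ?E y q a] by simp
      then have "cyc E q" using qE step True by (intro cyc_closed_spath) auto
      then have "chain E x (q # Cs) y"
        using Cs q True \<open>a \<noteq> y\<close> spath_ends_in_set[OF qE] by (intro chain.Cons) auto
      then show ?thesis by (rule exI)
    next
      case False
      then have "a \<notin> set q" using q a by auto
      then have "spath E a (a # q) z" using qE step by (intro spath_Cons) auto
      then show ?thesis
        using chain_ear[OF Cs assms(2), of "a # q" z y] False a q \<open>y \<notin> chain_verts x Cs\<close>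
          spath_ends_in_set[OF qE]
        by auto
    qed
  qed
qed

text \<open>One arc per cycle suffices. Each adds at most \<open>L\<close> vertices and the outer
  \<open>Suc\<close> counts \<open>x\<close>, so few short cycles mean a short distance.\<close>

lemma chain_spath:
  assumes "chain E x Cs y" "sym E" "\<forall>C\<in>set Cs. length C \<le> L"
  shows "\<exists>p. spath E x p y \<and> set p \<subseteq> chain_verts x Cs \<and> length p \<le> Suc (length Cs * L)"
  using assms
proof (induction rule: chain.induct)
  case Nil
  show ?case using spath_singleton by fastforce
next
  case (Cons Cs c C y)
  then obtain p where p: "spath E x p c" "set p \<subseteq> chain_verts x Cs" "length p \<le> Suc (length Cs * L)"
    by auto
  have C: "set C \<inter> chain_verts x Cs = {c}" "y \<in> set C" "y \<noteq> c" by fact+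
  obtain q where q: "spath E c q y" "set q \<subseteq> set C"
    using cyc_arc[OF \<open>cyc E C\<close> \<open>sym E\<close>, of c y c] C by blast
  have "distinct q" "distinct C" using q Cons by (auto simp: spath_def cyc_def)
  then have "length q \<le> length C" using q by (metis card_mono distinct_card finite_set)
  then have "length q \<le> L" using Cons.prems by auto
  have "set p \<inter> set q = {c}" using p q C spath_ends_in_set by fast
  note app = spath_append[OF p(1) q(1) this]
  have "length (p @ tl q) \<le> Suc (length (C # Cs) * L)"
    using p(3) \<open>length q \<le> L\<close> by auto
  then show ?case using app p q by (intro exI[of _ "p @ tl q"]) auto
qed

lemma chain_drop:
  assumes "chain E x Cs y" "n \<le> length Cs"
  shows "\<exists>Cs' y'. chain E x Cs' y' \<and> length Cs' = n"
  using assms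
proof (induction rule: chain.induct)
  case Nil
  then show ?case using chain.Nil[of E x] by auto
next
  case (Cons Cs c C y)
  show ?case
  proof (cases "n = length (C # Cs)")
    case True
    then show ?thesis using chain.Cons[OF Cons.hyps] by blast
  qed (use Cons in auto)
qed

section \<open>Fans and vertices of large degree\<close>

definition fan :: "'a rel \<Rightarrow> 'a \<Rightarrow> 'a set \<Rightarrow> 'a list set \<Rightarrow> bool" where
  "fan E u W F \<longleftrightarrow> finite F \<and> (\<forall>p\<in>F. \<exists>w\<in>W - {u}. spath E u p w) \<and>
     (\<forall>p\<in>F. \<forall>q\<in>F. p \<noteq> q \<longrightarrow> set p \<inter> set q = {u})"

lemma fan_mono: "fan E u W F \<Longrightarrow> W \<subseteq> W' \<Longrightarrow> fan E u W' F"
  unfolding fan_def by blast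

text \<open>A fan at \<open>u\<close> is enlarged greedily. When this gets stuck, every target is reached through one of
  the few vertices of the fan, so that one of these is close to many targets.\<close>

lemma fan_step:
  assumes IH: "\<And>(W :: 'a set) u. finite W \<Longrightarrow> N \<le> card W \<Longrightarrow>
      \<forall>w\<in>W. \<exists>p. spath E u p w \<and> length p \<le> h \<Longrightarrow> \<exists>u F. fan E u W F \<and> card F = r"
    and W: "finite W" "N * Suc (r * Suc h) + 2 \<le> card W"
      "\<forall>w\<in>W. \<exists>p. spath E u p w \<and> length p \<le> Suc h"
    and n: "n \<le> r"
  shows "(\<exists>u F. fan E u W F \<and> card F = r) \<or>
    (\<exists>F. fan E u W F \<and> card F = n \<and> (\<forall>p\<in>F. length p \<le> Suc h))"
  using n
proof (induction n)
  case 0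
  show ?case by (intro disjI2 exI[of _ "{}"]) (simp add: fan_def)
next
  case (Suc n)
  then consider "\<exists>u F. fan E u W F \<and> card F = r"
    | F where "fan E u W F" "card F = n" "\<forall>p\<in>F. length p \<le> Suc h"
    by auto
  then show ?case
  proof cases
    case 2
    define S where "S = insert u (\<Union>p\<in>F. set p)"
    have "finite F" using 2 by (simp add: fan_def)
    have "finite S" using \<open>finite F\<close> by (simp add: S_def)
    have "card (\<Union>p\<in>F. set p) \<le> (\<Sum>p\<in>F. card (set p))" using \<open>finite F\<close> by (rule card_UN_le)
    also have "\<dots> \<le> (\<Sum>p\<in>F. Suc h)"
      using 2 card_length order_trans by (intro sum_mono) blast
    also have "\<dots> = n * Suc h" using 2 by simp
    also have "\<dots> \<le> r * Suc h" using Suc.prems by (intro mult_le_mono1) simp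
    \<comment> \<open>At most \<open>r\<close> chosen paths with at most \<open>Suc h\<close>
      vertices each, and \<open>u\<close>.\<close>
    finally have "card S \<le> Suc (r * Suc h)"
      using \<open>finite F\<close> by (simp add: S_def card_insert_if)
    show ?thesis
    proof (cases "\<exists>w\<in>W - {u}. \<exists>p. spath E u p w \<and> length p \<le> Suc h \<and> set p \<inter> S = {u}")
      case True
      then obtain w p where p: "w \<in> W - {u}" "spath E u p w" "length p \<le> Suc h" "set p \<inter> S = {u}"
        by blast
      have "p \<notin> F" using p spath_ends_in_set[OF p(2)] by (auto simp: S_def)
      moreover have "\<forall>q\<in>F. set p \<inter> set q = {u}" 
      proof
        fix q assume "q \<in> F"
        then have "u \<in> set q" using 2 spath_ends_in_set unfolding fan_def by metis
        then show "set p \<inter> set q = {u}" using p \<open>q \<in> F\<close> by (auto simp: S_def)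
      qed
      ultimately have "fan E u W (insert p F)" "card (insert p F) = Suc n"
        using p 2 by (auto simp: fan_def)
      then show ?thesis using p 2 by blast
    next
      case False
      \<comment> \<open>No further path fits, so a path to \<open>w\<close> leaves \<open>S\<close>
        for the last time at some \<open>s \<noteq> u\<close>; its remainder has lost a vertex,
        hence the bound \<open>h\<close>.\<close>
      have "\<forall>w\<in>W - {u}. \<exists>s\<in>S - {u}. \<exists>q. spath E s q w \<and> length q \<le> h"
      proof
        fix w assume w: "w \<in> W - {u}"
        obtain p where p: "spath E u p w" "length p \<le> Suc h" using W(3) w by auto
        have "u \<in> S" by (simp add: S_def)
        with p(1) obtain q s where q: "spath E s q w" "set q \<inter> S = {s}" "length q \<le> length p"
          "s = u \<or> length q < length p"
          by (rule spath_last_hit)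
        have "s \<noteq> u" using False w p q by fastforce
        then show "\<exists>s\<in>S - {u}. \<exists>q. spath E s q w \<and> length q \<le> h" using q p by fastforce
      qed
      then obtain f where f: "\<And>w. w \<in> W - {u} \<Longrightarrow> f w \<in> S - {u}"
        "\<And>w. w \<in> W - {u} \<Longrightarrow> \<exists>q. spath E (f w) q w \<and> length q \<le> h"
        by metis
      \<comment> \<open>The summand 2 pays for a possible loss of \<open>u\<close> and for the
        strict inequality, from which the common factor is cancelled below.\<close>
      have "card (W - {u}) > N * Suc (r * Suc h)"
        using W by (cases "u \<in> W") auto
      have "W - {u} \<noteq> {}" using \<open>card (W - {u}) > _\<close> by force
      then have "S - {u} \<noteq> {}" using f(1) by blast
      then obtain s where s: "s \<in> S - {u}"
        "card (W - {u}) \<le> card (f -` {s} \<inter> (W - {u})) * card (S - {u})"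
        using pigeonhole_card[of f "W - {u}" "S - {u}"] f(1) W(1) \<open>finite S\<close> by auto
      have "N * Suc (r * Suc h) < card (f -` {s} \<inter> (W - {u})) * Suc (r * Suc h)"
        using \<open>card (W - {u}) > _\<close> s(2) \<open>card S \<le> _\<close> card_mono[OF \<open>finite S\<close>, of "S - {u}"]
        by (meson Diff_subset le_trans less_le_trans mult_le_mono2)
      then have "N \<le> card (f -` {s} \<inter> (W - {u}))"
        by (metis less_imp_le mult_less_cancel2)
      \<comment> \<open>All these targets are within \<open>h\<close> of the single vertex
        \<open>s\<close>; the fan obtained from them may have yet another centre
        \<open>u'\<close>.\<close>
      then have "\<exists>u' F. fan E u' (f -` {s} \<inter> (W - {u})) F \<and> card F = r"
        using W(1) f(2) by (intro IH[of _ s]) auto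
      then show ?thesis using fan_mono by (metis Diff_subset inf.coboundedI2)
    qed
  qed blast
qed

text \<open>The factor \<open>Suc (r * Suc h)\<close> bounds the number of vertices of a stuck fan,
  among which the targets are shared out. Lengths count vertices, so for \<open>h = 0\<close> a
  single target is already contradictory.\<close>

fun fan_bound :: "nat \<Rightarrow> nat \<Rightarrow> nat" where
  "fan_bound r 0 = 1"
| "fan_bound r (Suc h) = fan_bound r h * Suc (r * Suc h) + 2"

lemma fan_bound_pos: "0 < fan_bound r h"
  by (cases h) auto

lemma fan_exists:
  assumes "finite W" "fan_bound r h \<le> card W" "\<forall>w\<in>W. \<exists>p. spath E u p w \<and> length p \<le> h"
  shows "\<exists>u F. fan E u W F \<and> card F = r"
  using assms
proof (induction h arbitrary: W u)
  case 0
  then have "W \<noteq> {}" by auto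
  then show ?case using 0 by (auto simp: spath_def)
next
  case (Suc h)
  have "(\<exists>u F. fan E u W F \<and> card F = r) \<or>
    (\<exists>F. fan E u W F \<and> card F = r \<and> (\<forall>p\<in>F. length p \<le> Suc h))"
    by (rule fan_step[of "fan_bound r h", OF Suc.IH])
      (use Suc.prems in \<open>simp_all only: fan_bound.simps order.refl\<close>)
  then show ?case by blast
qed

lemma fan_second_vertex:
  assumes "fan E u W F" "p \<in> F"
  shows "hd (tl p) \<in> set p" "hd (tl p) \<noteq> u" "(u, hd (tl p)) \<in> E"
proof -
  obtain w where "w \<noteq> u" "spath E u p w" using assms unfolding fan_def by blast
  then obtain x q where "p = u # x # q" by (cases p; cases "tl p") (auto simp: spath_def)
  then show "hd (tl p) \<in> set p" "hd (tl p) \<noteq> u" "(u, hd (tl p)) \<in> E"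
    using \<open>spath E u p w\<close> by (auto simp: spath_def)
qed

text \<open>The second vertices of the paths are pairwise different neighbours of \<open>u\<close>,
  since two paths share only \<open>u\<close>.\<close>

lemma fan_degree:
  assumes "fan E u W F" "finite E"
  shows "card F \<le> card {w. (u, w) \<in> E}"
proof (rule card_inj_on_le[of "\<lambda>p. hd (tl p)"])
  note second = fan_second_vertex[OF assms(1)]
  show "inj_on (\<lambda>p. hd (tl p)) F"
  proof (rule inj_onI, rule ccontr)
    fix p q assume pq: "p \<in> F" "q \<in> F" "hd (tl p) = hd (tl q)" "p \<noteq> q"
    then have "set p \<inter> set q = {u}" using assms by (simp add: fan_def)
    then show False using second pq by (metis IntI singletonD)
  qed
  show "(\<lambda>p. hd (tl p)) ` F \<subseteq> {w. (u, w) \<in> E}" using second by blast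
  have "{w. (u, w) \<in> E} \<subseteq> snd ` E" by force
  then show "finite {w. (u, w) \<in> E}" using assms(2) finite_subset by blast
qed

text \<open>Greedy choice: each element chosen so far rules out fewer than \<open>M\<close>
  candidates, itself included by reflexivity. With reachability for \<open>R\<close> this picks
  vertices in different components.\<close>

lemma unrelated_subset:
  assumes "finite W" "r * M \<le> card W" "\<And>a. a \<in> W \<Longrightarrow> card {b \<in> W. R a b} < M" "n \<le> r"
    "\<And>a b. R a b \<Longrightarrow> R b a" "\<And>a. R a a" "0 < M"
  shows "\<exists>A\<subseteq>W. card A = n \<and> (\<forall>a\<in>A. \<forall>b\<in>A. a \<noteq> b \<longrightarrow> \<not> R a b)"
  using assms(4)
proof (induction n)
  case 0
  show ?case by (intro exI[of _ "{}"]) simp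
next
  case (Suc n)
  then obtain A where A: "A \<subseteq> W" "card A = n" "\<forall>a\<in>A. \<forall>b\<in>A. a \<noteq> b \<longrightarrow> \<not> R a b" by auto
  have "finite A" using A assms(1) finite_subset by blast
  have "card (\<Union>a\<in>A. {b \<in> W. R a b}) < card W"
  proof (cases "n = 0")
    case True
    have "0 < r * M" using assms(7) Suc.prems by simp
    then have "0 < card W" using assms(2) by linarith
    then show ?thesis using True A \<open>finite A\<close> by simp
  next
    case False
    have "card (\<Union>a\<in>A. {b \<in> W. R a b}) \<le> (\<Sum>a\<in>A. card {b \<in> W. R a b})"
      using \<open>finite A\<close> by (rule card_UN_le)
    also have "\<dots> < (\<Sum>a\<in>A. M)"
      using False A assms(3) \<open>finite A\<close> by (intro sum_strict_mono) auto
    also have "\<dots> = n * M" using A by simp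
    also have "\<dots> \<le> r * M" using Suc.prems by (intro mult_le_mono1) simp
    finally show ?thesis using assms(2) by simp
  qed
  then obtain b where b: "b \<in> W" "\<forall>a\<in>A. \<not> R a b"
    using card_mono[of "\<Union>a\<in>A. {b \<in> W. R a b}" W] assms(1) \<open>finite A\<close> by fastforce
  then have "b \<notin> A" using assms(6) by blast
  then have "card (insert b A) = Suc n" using A \<open>finite A\<close> by simp
  moreover have "\<forall>x\<in>insert b A. \<forall>y\<in>insert b A. x \<noteq> y \<longrightarrow> \<not> R x y"
    using A b assms(5) by blast
  ultimately show ?case using A b by (intro exI[of _ "insert b A"]) simp
qed

text \<open>The four outcomes at the level of relations. A fan that avoids \<open>v\<close> and ends
  in neighbours of \<open>v\<close> becomes a subdivision of K_{2,r} once \<open>v\<close> is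
  appended to each path. Petals are indexed by vertices, later by one neighbour of the centre each,
  which keeps the index set in the type \<open>'a set\<close>.\<close>

definition unavoidable :: "nat \<Rightarrow> 'a rel \<Rightarrow> bool" where
  "unavoidable r E \<longleftrightarrow>
     (\<exists>vs. cyc E vs \<and> r \<le> length vs) \<or>
     (\<exists>x Cs y. chain E x Cs y \<and> length Cs = r) \<or>
     (\<exists>v (A :: 'a set) c. finite A \<and> card A = r \<and> (\<forall>a\<in>A. cyc E (c a) \<and> v \<in> set (c a)) \<and>
        (\<forall>a\<in>A. \<forall>b\<in>A. a \<noteq> b \<longrightarrow> set (c a) \<inter> set (c b) = {v})) \<or>
     (\<exists>u v F. fan (avoiding v E) u {w. (v, w) \<in> E} F \<and> card F = r \<and> u \<noteq> v)"

theorem unavoidable_configuration: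
  assumes "1 \<le> r"
  obtains f where "\<And>(V :: 'a set) E. finite V \<Longrightarrow> E \<subseteq> V \<times> V \<Longrightarrow> sym E \<Longrightarrow> irrefl E \<Longrightarrow>
    bridgeless E \<Longrightarrow> \<forall>x\<in>V. \<forall>y\<in>V. (x, y) \<in> E\<^sup>* \<Longrightarrow> f \<le> card V \<Longrightarrow> unavoidable r E"
proof -
  \<comment> \<open>Paths off \<open>v\<close> between neighbours of \<open>v\<close> will have at
    most \<open>r\<close> vertices, so \<open>M\<close> neighbours in one component give a fan of
    size \<open>r\<close>.\<close>
  define M where "M = fan_bound r r"
  \<comment> \<open>Fewer than \<open>r\<close> cycles of order below \<open>r\<close> keep
    distances, counted in vertices, within \<open>Suc (r * r)\<close>. The fan of size
    \<open>Suc (r * M)\<close> is wanted for the degree of its centre: among \<open>r * M\<close>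
    neighbours, fewer than \<open>M\<close> per component means at least \<open>r\<close>
    components.\<close>
  define N where "N = fan_bound (Suc (r * M)) (Suc (r * r))"
  show ?thesis
  proof (rule that[of N])
    fix V and E :: "'a rel"
    assume V: "finite V" "E \<subseteq> V \<times> V" "sym E" "irrefl E" "bridgeless E"
      "\<forall>x\<in>V. \<forall>y\<in>V. (x, y) \<in> E\<^sup>*" "N \<le> card V"
    have "finite E" using V finite_subset by blast
    obtain x where "x \<in> V" using V(7) fan_bound_pos unfolding N_def by fastforce
    show "unavoidable r E"
    proof (cases "(\<exists>vs. cyc E vs \<and> r \<le> length vs) \<or>
        (\<exists>x Cs y. chain E x Cs y \<and> length Cs = r)")
      case False
      have short: "length vs < r" if "cyc E vs" for vs
        using False that by (meson not_le)
      have short_chain: "length Cs < r" if "chain E x Cs y" for x Cs y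
        using False chain_drop[OF that, of r] by (meson not_le)
      have "\<exists>p. spath E x p y \<and> length p \<le> Suc (r * r)" if "y \<in> V" for y
      proof -
        obtain Cs where Cs: "chain E x Cs y" using chain_exists[OF _ V(3-5)] V(6) \<open>x \<in> V\<close> \<open>y \<in> V\<close> by metis
        moreover have "\<forall>C\<in>set Cs. length C \<le> r"
        proof -
          have "\<forall>C\<in>set Cs. cyc E C" using Cs by (induction rule: chain.induct) auto
          then show ?thesis using short by (simp add: less_imp_le)
        qed
        ultimately obtain p where p: "spath E x p y" "length p \<le> Suc (length Cs * r)"
          using chain_spath V(3) by meson
        have "length Cs * r \<le> r * r" using short_chain[OF Cs] by (intro mult_le_mono1) simp
        then show ?thesis using p by (meson Suc_le_mono le_trans)
      qed
      then obtain v F where "fan E v V F" "card F = Suc (r * M)"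
        using fan_exists[OF V(1,7)[unfolded N_def]] by blast
      define W where "W = {w. (v, w) \<in> E}"
      have W: "finite W" "r * M \<le> card W"
      proof -
        show "r * M \<le> card W"
          using fan_degree[OF \<open>fan E v V F\<close> \<open>finite E\<close>] \<open>card F = _\<close> by (simp add: W_def)
        have "W \<subseteq> V" using V(2) by (auto simp: W_def)
        then show "finite W" using V(1) finite_subset by blast
      qed
      define E' where "E' = avoiding v E"
      have "E' \<subseteq> E" "sym E'" using V(3) by (auto simp: E'_def sym_def)
      have nv: "a \<noteq> v" if "a \<in> W" for a using V(4) that by (auto simp: W_def irrefl_def)
      \<comment> \<open>Deleting \<open>v\<close> leaves it isolated in the relation, so that paths
        starting elsewhere never visit it.\<close>
      have off_v: "b \<noteq> v" if "(a, b) \<in> E'\<^sup>*" "a \<noteq> v" for a b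
        using that by (induction rule: rtrancl_induct) (auto simp: E'_def)
      show ?thesis
      proof (cases "\<exists>a\<in>W. M \<le> card {b \<in> W. (a, b) \<in> E'\<^sup>*}")
        case True
        then obtain a where a: "a \<in> W" "M \<le> card {b \<in> W. (a, b) \<in> E'\<^sup>*}" by blast
        have "\<exists>p. spath E' a p b \<and> length p \<le> r" if b: "b \<in> W" "(a, b) \<in> E'\<^sup>*" for b
        proof -
          obtain p where p: "spath E' a p b" using b(2) by (rule rtrancl_imp_spath)
          have "length p \<le> r"
          proof (rule ccontr)
            assume "\<not> length p \<le> r"
            have "a \<noteq> v" using a(1) nv by blast
            then have "v \<notin> set p" using spath_imp_rtrancl[OF p] off_v by blast
            moreover have "(v, a) \<in> E" "(b, v) \<in> E" using a(1) b(1) V(3) by (auto simp: W_def dest: symD)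
            ultimately have s: "spath E v (v # p) b"
              using p \<open>E' \<subseteq> E\<close> by (intro spath_Cons[of E a]) (auto intro: spath_mono)
            have "cyc E (v # p)"
              using s \<open>(b, v) \<in> E\<close> by (rule cyc_closed_spath)
                (use \<open>\<not> length p \<le> r\<close> assms in simp)
            then show False using short \<open>\<not> length p \<le> r\<close> by fastforce
          qed
          then show ?thesis using p by blast
        qed
        then obtain u F where F: "fan E' u {b \<in> W. (a, b) \<in> E'\<^sup>*} F" "card F = r"
          using fan_exists[OF _ a(2)[unfolded M_def], of E' a] W(1) by auto
        \<comment> \<open>Since \<open>r\<close> is positive, the fan has a path, and the first arc
          of this path leaves \<open>u\<close> inside \<open>avoiding v E\<close>.\<close>
        have "u \<noteq> v"
        proof -
          obtain p where "p \<in> F" using F(2) assms by fastforce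
          then show ?thesis using fan_second_vertex(3)[OF F(1)] by (auto simp: E'_def)
        qed
        moreover have "fan E' u W F" using F(1) by (rule fan_mono) blast
        ultimately show ?thesis using F(2) unfolding unavoidable_def E'_def W_def by blast
      next
        case False
        then obtain A where A: "A \<subseteq> W" "card A = r" "\<forall>a\<in>A. \<forall>b\<in>A. a \<noteq> b \<longrightarrow> (a, b) \<notin> E'\<^sup>*"
          using unrelated_subset[OF W, of "\<lambda>a b. (a, b) \<in> E'\<^sup>*" r] sym_rtrancl[OF \<open>sym E'\<close>]
            fan_bound_pos unfolding M_def by (auto simp: not_le dest: symD)
        \<comment> \<open>The petal at \<open>a\<close> is a detour around the edge
          \<open>av\<close>. Without its final vertex \<open>v\<close> it stays in the component of
          \<open>a\<close>, so petals of different components meet only in \<open>v\<close>.\<close>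
        have "\<exists>p. cyc E p \<and> v \<in> set p \<and> (\<forall>x\<in>set p - {v}. (a, x) \<in> E'\<^sup>*)" if "a \<in> A" for a
        proof -
          have av: "(v, a) \<in> E" "(a, v) \<in> E" "a \<noteq> v" 
            using A(1) that V(3) nv by (auto simp: W_def dest: symD)
          obtain p where p: "spath (E - {(a, v), (v, a)}) a p v"
            using V(5) av(2) by (rule bridgelessD)
          have "cyc E p"
          proof (rule cyc_closed_spath)
            show "spath E a p v" using p by (rule spath_mono) blast
            show "3 \<le> length p" using p av by (intro spath_length_ge_3) auto
          qed (rule av)
          moreover have "(a, x) \<in> E'\<^sup>*" if "x \<in> set p - {v}" for x
          proof -
            obtain q where q: "p = q @ [v]" using p by (metis append_butlast_last_id spath_def)
            then have x: "x \<in> set q" using that by auto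
            then have "q \<noteq> []" by auto
            then have "spath E a q (last q)" "v \<notin> set q"
              using p by (auto simp: q spath_def set_vwalk_arcs_append)
            then have "spath E' a q (last q)"
              unfolding spath_def E'_def using vwalk_arcs_in_set by fast
            then show ?thesis using x by (rule spath_imp_rtrancl)
          qed
          moreover have "v \<in> set p" using spath_ends_in_set[OF p] by blast
          ultimately show ?thesis by blast
        qed
        then obtain c where c: "\<And>a. a \<in> A \<Longrightarrow> cyc E (c a)" "\<And>a. a \<in> A \<Longrightarrow> v \<in> set (c a)"
          "\<And>a x. a \<in> A \<Longrightarrow> x \<in> set (c a) - {v} \<Longrightarrow> (a, x) \<in> E'\<^sup>*"
          by metis
        have "set (c a) \<inter> set (c b) = {v}" if ab: "a \<in> A" "b \<in> A" "a \<noteq> b" for a b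
        proof -
          have False if "x \<in> set (c a)" "x \<in> set (c b)" "x \<noteq> v" for x
          proof -
            have "(a, x) \<in> E'\<^sup>*" "(x, b) \<in> E'\<^sup>*"
              using c(3) ab that sym_rtrancl[OF \<open>sym E'\<close>] by (auto dest: symD)
            then show False using A(3) ab by (meson rtrancl_trans)
          qed
          then show ?thesis using c(2) ab by blast
        qed
        moreover have "finite A" using A(1) W(1) finite_subset by blast
        ultimately show ?thesis
          unfolding unavoidable_def using A(2) c(1,2)
          by (intro disjI2[OF disjI2[OF disjI1]] exI[of _ v] exI[of _ A] exI[of _ c]) simp
      qed
    qed (unfold unavoidable_def, blast)
  qed
qed

section \<open>Subdivisions and minors of pair graphs\<close>

definition graph_Union :: "'i set \<Rightarrow> ('i \<Rightarrow> 'a pair_pre_digraph) \<Rightarrow> 'a pair_pre_digraph" where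
  "graph_Union I H = \<lparr>pverts = \<Union>i\<in>I. pverts (H i), parcs = \<Union>i\<in>I. parcs (H i)\<rparr>"

lemma graph_Union_simps [simp]:
  "pverts (graph_Union I H) = (\<Union>i\<in>I. pverts (H i))"
  "parcs (graph_Union I H) = (\<Union>i\<in>I. parcs (H i))"
  by (simp_all add: graph_Union_def)

abbreviation graph_union :: "'a pair_pre_digraph \<Rightarrow> 'a pair_pre_digraph \<Rightarrow> 'a pair_pre_digraph" where
  "graph_union G H \<equiv> \<lparr>pverts = pverts G \<union> pverts H, parcs = parcs G \<union> parcs H\<rparr>"

lemma pair_bidirected_digraph_iff:
  "pair_bidirected_digraph G \<longleftrightarrow>
     parcs G \<subseteq> pverts G \<times> pverts G \<and> sym (parcs G) \<and> irrefl (parcs G)"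
  by (auto simp: pair_bidirected_digraph_def pair_sym_digraph_def pair_sym_digraph_axioms_def
      pair_wf_digraph_def pair_loopfree_digraph_def pair_loopfree_digraph_axioms_def symmetric_def
      irrefl_def) 

lemma pair_graph_iff:
  "pair_graph G \<longleftrightarrow> finite (pverts G) \<and> pair_bidirected_digraph G"
proof
  assume "pair_graph G"
  then interpret pair_graph G .
  show "finite (pverts G) \<and> pair_bidirected_digraph G" by (auto intro: pair_bidirected_digraph_axioms)
next
  assume *: "finite (pverts G) \<and> pair_bidirected_digraph G"
  then interpret pair_bidirected_digraph G by blast
  have "parcs G \<subseteq> pverts G \<times> pverts G" using * by (simp add: pair_bidirected_digraph_iff)
  then have "finite (parcs G)" using * finite_subset by blast
  then show "pair_graph G" using * by unfold_locales auto
qed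

lemma pair_bidirected_graph_Union:
  "(\<And>i. i \<in> I \<Longrightarrow> pair_bidirected_digraph (H i)) \<Longrightarrow> pair_bidirected_digraph (graph_Union I H)"
  unfolding pair_bidirected_digraph_iff irrefl_def sym_def by simp blast

lemma pair_bidirected_graph_union:
  "pair_bidirected_digraph G \<Longrightarrow> pair_bidirected_digraph H \<Longrightarrow>
    pair_bidirected_digraph (graph_union G H)"
  unfolding pair_bidirected_digraph_iff irrefl_def sym_def by (auto 4 3)

lemma subgraph_with_proj_iff:
  "pair_bidirected_digraph H \<Longrightarrow> pair_bidirected_digraph G \<Longrightarrow>
    subgraph (with_proj H) (with_proj G) \<longleftrightarrow> pverts H \<subseteq> pverts G \<and> parcs H \<subseteq> parcs G"
  by (auto simp: subgraph_def compatible_def wf_digraph_wp_iff pair_bidirected_digraph_def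
      pair_sym_digraph_def)

text \<open>A subdivision step replaces an old edge by edges at the new vertex, so old vertices
  persist and no new arc joins two of them.\<close>

lemma subdivision_pair_preserves:
  assumes "subdivision_pair X H"
  shows "pverts X \<subseteq> pverts H \<and> parcs H \<inter> pverts X \<times> pverts X \<subseteq> parcs X"
  using assms
proof (induction rule: subdivision_pair_induct)
  case (divide e w H)
  then show ?case by (cases e) (auto simp: subdivide.simps)
qed auto

lemma subdivision_pair_bidirected:
  assumes "subdivision_pair X H"
  shows "pair_bidirected_digraph X" "pair_bidirected_digraph H"
proof -
  show "pair_bidirected_digraph X"
    using assms by (induction rule: subdivision_pair_induct) auto
  show "pair_bidirected_digraph H"
    using assms by (rule bidirected_digraphI_subdivision)
qed

text \<open>\<open>Z\<close> is carried along unchanged. It contains none of the new vertices, and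
  none of the arcs being subdivided, which would otherwise survive in the union.\<close>

lemma subdivision_pair_union:
  assumes "subdivision_pair X H" "pair_bidirected_digraph Z" "pverts Z \<inter> pverts H \<subseteq> pverts X"
    "parcs Z \<inter> parcs X = {}"
  shows "subdivision_pair (graph_union X Z) (graph_union H Z)"
  using assms
proof (induction rule: subdivision_pair_induct)
  case base
  then show ?case by (intro subdivision_pair_base pair_bidirected_graph_union)
next
  case (divide e w H)
  obtain u v where e: "e = (u, v)" by (cases e)
  note preserves = subdivision_pair_preserves[OF divide.hyps(3)]
  have w: "w \<notin> pverts Z" using divide preserves by auto
  have wf: "parcs H \<subseteq> pverts H \<times> pverts H" "sym (parcs H)" "parcs Z \<subseteq> pverts Z \<times> pverts Z"
    using subdivision_pair_bidirected(2)[OF divide.hyps(3)] divide.prems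
    by (auto simp: pair_bidirected_digraph_iff)
  have IH: "subdivision_pair (graph_union X Z) (graph_union H Z)"
    using divide by auto
  \<comment> \<open>A common arc would have both ends in \<open>X\<close>, and between vertices of
    \<open>X\<close> the graph \<open>H\<close> has only arcs of \<open>X\<close>.\<close>
  have "(a, b) \<notin> parcs Z" if "(a, b) \<in> parcs H" for a b
  proof
    assume Z: "(a, b) \<in> parcs Z"
    then have "a \<in> pverts X" "b \<in> pverts X" using that wf divide.prems by auto
    then have "(a, b) \<in> parcs X" using that preserves by blast
    then show False using Z divide.prems by blast
  qed
  then have "(u, v) \<notin> parcs Z" "(v, u) \<notin> parcs Z"
    using divide.hyps(1) wf(2) by (auto simp: e dest: symD)
  then have "graph_union (subdivide H e w) Z = subdivide (graph_union H Z) e w"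
    by (auto simp: e subdivide.simps)
  then show ?case
    using subdivision_pair_divide[OF _ _ IH, of e w] divide.hyps w by simp
qed

lemma subdivision_pair_trans:
  "subdivision_pair X Y \<Longrightarrow> subdivision_pair Y Z \<Longrightarrow> subdivision_pair X Z"
  by (rule subdivision_trans)

text \<open>Two stages per piece: \<open>X i\<close> is subdivided while the others are still in
  their original form, then the others are subdivided next to the finished \<open>H i\<close>.
  Pieces may meet only in original vertices and share no edge.\<close>

lemma subdivision_pair_Union:
  fixes X :: "'i \<Rightarrow> 'a pair_pre_digraph"
  assumes "finite I" "\<And>i. i \<in> I \<Longrightarrow> subdivision_pair (X i) (H i)"
    "\<And>i j. i \<in> I \<Longrightarrow> j \<in> I \<Longrightarrow> i \<noteq> j \<Longrightarrow> pverts (H i) \<inter> pverts (H j) \<subseteq> pverts (X i)"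
    "\<And>i j. i \<in> I \<Longrightarrow> j \<in> I \<Longrightarrow> i \<noteq> j \<Longrightarrow> parcs (X i) \<inter> parcs (X j) = {}"
  shows "subdivision_pair (graph_Union I X) (graph_Union I H)"
  using assms
proof (induction rule: finite_induct)
  case empty
  have "graph_Union {} X = \<lparr>pverts = {}, parcs = {}\<rparr>" for X :: "'i \<Rightarrow> 'a pair_pre_digraph"
    by (simp add: graph_Union_def)
  moreover have "pair_bidirected_digraph \<lparr>pverts = {} :: 'a set, parcs = {}\<rparr>"
    by (simp add: pair_bidirected_digraph_iff sym_def irrefl_def)
  ultimately show ?case by (metis subdivision_pair_base)
next
  case (insert i I)
  have bi: "pair_bidirected_digraph (X j)" "pair_bidirected_digraph (H j)" if "j \<in> insert i I" for j
    using subdivision_pair_bidirected insert.prems(1) that by blast+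
  have sub: "pverts (X j) \<subseteq> pverts (H j)" if "j \<in> insert i I" for j
    using subdivision_pair_preserves insert.prems(1) that by blast
  have int: "pverts (H i) \<inter> pverts (H j) \<subseteq> pverts (X i)" "pverts (H i) \<inter> pverts (H j) \<subseteq> pverts (X j)"
    "parcs (X i) \<inter> parcs (X j) = {}" if "j \<in> I" for j
    using insert.prems(2)[of i j] insert.prems(2)[of j i] insert.prems(3)[of i j] insert.hyps that
    by auto
  have "subdivision_pair (graph_union (X i) (graph_Union I X)) (graph_union (H i) (graph_Union I X))"
  proof (rule subdivision_pair_union)
    show "subdivision_pair (X i) (H i)" using insert.prems by blast
    show "pair_bidirected_digraph (graph_Union I X)" using bi by (intro pair_bidirected_graph_Union) auto
    show "pverts (graph_Union I X) \<inter> pverts (H i) \<subseteq> pverts (X i)" using int sub by fastforce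
    show "parcs (graph_Union I X) \<inter> parcs (X i) = {}" using int(3) by fastforce
  qed
  moreover have "subdivision_pair (graph_union (graph_Union I X) (H i)) (graph_union (graph_Union I H) (H i))"
  proof (rule subdivision_pair_union)
    show "subdivision_pair (graph_Union I X) (graph_Union I H)" using insert by auto
    show "pair_bidirected_digraph (H i)" using bi by auto
    show "pverts (H i) \<inter> pverts (graph_Union I H) \<subseteq> pverts (graph_Union I X)" using int by fastforce
    have "(a, b) \<notin> parcs (X j)" if "j \<in> I" "(a, b) \<in> parcs (H i)" for j a b
    proof
      assume ab: "(a, b) \<in> parcs (X j)"
      have "{a, b} \<subseteq> pverts (X j)" "{a, b} \<subseteq> pverts (H i)"
        using bi[of i] bi[of j] ab that unfolding pair_bidirected_digraph_iff by auto
      then have "{a, b} \<subseteq> pverts (X i)" using int(1)[OF that(1)] sub[of j] that(1) by blast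
      then have "(a, b) \<in> parcs (X i)"
        using subdivision_pair_preserves[OF insert.prems(1)[of i]] that by auto
      then show False using int(3)[OF that(1)] ab by blast
    qed
    then show "parcs (H i) \<inter> parcs (graph_Union I X) = {}" by auto
  qed
  moreover have "graph_union (H i) (graph_Union I X) = graph_union (graph_Union I X) (H i)"
    by (simp add: Un_commute)
  ultimately have "subdivision_pair (graph_union (X i) (graph_Union I X))
      (graph_union (graph_Union I H) (H i))"
    by (metis subdivision_pair_trans)
  then show ?case by (simp add: graph_Union_def Un_commute)
qed

section \<open>Shortening cycles and paths\<close>

definition cycle_of :: "'a list \<Rightarrow> 'a pair_pre_digraph" where
  "cycle_of vs = \<lparr>pverts = set vs, parcs = symcl (set (vwalk_arcs (vs @ [hd vs])))\<rparr>"

definition path_of :: "'a list \<Rightarrow> 'a pair_pre_digraph" where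
  "path_of vs = \<lparr>pverts = set vs, parcs = symcl (set (vwalk_arcs vs))\<rparr>"

lemma cycle_of_simps [simp]:
  "pverts (cycle_of vs) = set vs" "parcs (cycle_of vs) = symcl (set (vwalk_arcs (vs @ [hd vs])))"
  by (simp_all add: cycle_of_def)

lemma path_of_simps [simp]:
  "pverts (path_of vs) = set vs" "parcs (path_of vs) = symcl (set (vwalk_arcs vs))"
  by (simp_all add: path_of_def)

lemma cycle_graph_iff: "cycle_graph C \<longleftrightarrow> (\<exists>vs. 3 \<le> length vs \<and> distinct vs \<and> C = cycle_of vs)"
  unfolding cycle_graph_def by (auto simp: cycle_of_def)

lemma cycle_graph_rotate:
  assumes "cycle_graph C" "a \<in> pverts C"
  obtains ws where "2 \<le> length ws" "distinct (a # ws)" "C = cycle_of (a # ws)"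
proof -
  obtain vs where vs: "3 \<le> length vs" "distinct vs" "C = cycle_of vs"
    using assms(1) unfolding cycle_graph_iff by blast
  then have "a \<in> set vs" using assms by simp
  then obtain ws where ws: "hd ws = a" "ws \<noteq> []" "set ws = set vs" "length ws = length vs"
    "distinct ws \<longleftrightarrow> distinct vs"
    "set (vwalk_arcs (ws @ [hd ws])) = set (vwalk_arcs (vs @ [hd vs]))"
    by (rule cycle_rotate)
  have "C = cycle_of ws" unfolding vs(3) cycle_of_def ws(3,6) ..
  moreover from ws(1,2) have "ws = a # tl ws" by (cases ws) auto
  ultimately show ?thesis using that[of "tl ws"] vs ws
    by (metis Suc_le_mono length_Cons numeral_2_eq_2 numeral_3_eq_3)
qed

lemma sym_symcl: "sym (symcl R)"
  by (auto simp: sym_def symcl_def)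

lemma symcl_subset: "R \<subseteq> S \<Longrightarrow> sym S \<Longrightarrow> symcl R \<subseteq> S"
  by (auto simp: symcl_def sym_def)

lemma in_symcl_iff: "(x, y) \<in> symcl R \<longleftrightarrow> (x, y) \<in> R \<or> (y, x) \<in> R"
  by (auto simp: symcl_def)

lemma irrefl_vwalk_arcs: "distinct vs \<Longrightarrow> (x, x) \<notin> set (vwalk_arcs vs)"
  by (induction vs rule: vwalk_arcs.induct) auto

lemma path_of_bidirected: "distinct vs \<Longrightarrow> pair_bidirected_digraph (path_of vs)"
  using irrefl_vwalk_arcs[of vs] 
  by (auto simp: pair_bidirected_digraph_iff sym_symcl irrefl_def in_symcl_iff dest: vwalk_arcs_in_set)

lemma cycle_graph_pair_graph:
  assumes "cycle_graph C"
  shows "pair_graph C"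
proof -
  obtain vs where vs: "3 \<le> length vs" "distinct vs" "C = cycle_of vs"
    using assms unfolding cycle_graph_iff by blast
  then obtain x xs where "vs = x # xs" "xs \<noteq> []" by (cases vs; cases "tl vs") auto
  then have "vs \<noteq> []" "last vs \<noteq> hd vs" using vs(2) by auto
  then show ?thesis
    using vs irrefl_vwalk_arcs[of vs]
    by (auto simp: pair_graph_iff pair_bidirected_digraph_iff sym_symcl irrefl_def in_symcl_iff
        set_vwalk_arcs_append dest: vwalk_arcs_in_set)
qed

lemma cycle_graph_card: "cycle_graph C \<Longrightarrow> 3 \<le> card (pverts C)"
  by (auto simp: cycle_graph_iff distinct_card)

text \<open>Suppressing a vertex \<open>w\<close> outside \<open>S\<close> and joining its two
  neighbours leaves a cycle from which \<open>C\<close> arises by one subdivision. \<open>S\<close>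
  stands for the vertices at which the cycle is glued to others.\<close>

lemma cycle_graph_shrink_step:
  assumes "cycle_graph C" "card (pverts C) = Suc n" "3 \<le> n" "S \<subseteq> pverts C" "card S \<le> n"
  shows "\<exists>C'. cycle_graph C' \<and> card (pverts C') = n \<and> S \<subseteq> pverts C' \<and> subdivision_pair C' C"
proof -
  have "S \<noteq> pverts C" using assms by auto
  then obtain w where w: "w \<in> pverts C" "w \<notin> S" using assms(4) by blast
  obtain ws where ws: "distinct (w # ws)" "C = cycle_of (w # ws)"
    using assms(1) w(1) by (rule cycle_graph_rotate)
  have len: "length ws = n" using ws assms(2) by (simp add: distinct_card)
  have C': "cycle_graph (cycle_of ws)"
    using ws len assms(3) unfolding cycle_graph_iff by auto
  have "ws \<noteq> []" using len assms(3) by auto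
  \<comment> \<open>With at least three vertices left, the closing edge of the shorter cycle is no
    edge of the path \<open>ws\<close>, so subdividing it leaves that path intact.\<close>
  have ne: "(last ws, hd ws) \<notin> set (vwalk_arcs ws)" "(hd ws, last ws) \<notin> set (vwalk_arcs ws)"
  proof -
    obtain a b xs where abx: "ws = a # b # xs" "xs \<noteq> []" using len assms(3)
      by (cases ws; cases "tl ws"; cases "tl (tl ws)") auto
    show "(last ws, hd ws) \<notin> set (vwalk_arcs ws)" "(hd ws, last ws) \<notin> set (vwalk_arcs ws)"
      using ws(1) abx vwalk_arcs_in_set[of "last xs" a xs] vwalk_arcs_in_set[of a "last xs" xs] by auto
  qed
  have "C = subdivide (cycle_of ws) (last ws, hd ws) w"
    unfolding ws(2) using \<open>ws \<noteq> []\<close> ws(1) ne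
    by (auto simp: cycle_of_def subdivide.simps set_vwalk_arcs_append symcl_def)
  moreover have "subdivision_pair (cycle_of ws) (subdivide (cycle_of ws) (last ws, hd ws) w)"
    using ws(1) \<open>ws \<noteq> []\<close> C'[THEN cycle_graph_pair_graph]
    by (intro subdivision_pair_divide subdivision_pair_base)
      (auto simp: pair_graph_iff set_vwalk_arcs_append symcl_def)
  ultimately have "subdivision_pair (cycle_of ws) C" by simp
  moreover have "card (pverts (cycle_of ws)) = n" "S \<subseteq> pverts (cycle_of ws)"
    using ws len w assms(4) by (auto simp: distinct_card)
  ultimately show ?thesis using C' by blast
qed

lemma cycle_graph_shrink:
  assumes "cycle_graph C" "3 \<le> n" "n \<le> card (pverts C)" "S \<subseteq> pverts C" "card S \<le> n"
  shows "\<exists>C'. cycle_graph C' \<and> card (pverts C') = n \<and> S \<subseteq> pverts C' \<and> subdivision_pair C' C"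
  using assms(1,3,4)
proof (induction "card (pverts C) - n" arbitrary: C)
  case 0
  then have "subdivision_pair C C"
    using cycle_graph_pair_graph by (intro subdivision_pair_base) (auto simp: pair_graph_iff)
  then show ?case using 0 by (intro exI[of _ C]) auto
next
  case (Suc m)
  then have "\<exists>C'. cycle_graph C' \<and> card (pverts C') = n + m \<and> S \<subseteq> pverts C' \<and> subdivision_pair C' C"
    using assms(2,5) by (intro cycle_graph_shrink_step) auto
  then obtain C' where C': "cycle_graph C'" "card (pverts C') = n + m" "S \<subseteq> pverts C'"
    "subdivision_pair C' C"
    by blast
  then have "\<exists>C''. cycle_graph C'' \<and> card (pverts C'') = n \<and> S \<subseteq> pverts C'' \<and>
      subdivision_pair C'' C'"
    by (intro Suc.hyps(1)) auto
  then show ?case using subdivision_pair_trans C'(4) by blast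
qed

text \<open>The vertices of \<open>p\<close> are inserted one by one on the edge at
  \<open>u\<close>. The neighbour \<open>w\<close> of \<open>v\<close> survives because it becomes a
  vertex of the class of size \<open>r\<close> in K_{2,r}.\<close>

lemma path_of_shrink:
  assumes "distinct (u # p @ [w, v])"
  shows "subdivision_pair (path_of [u, w, v]) (path_of (u # p @ [w, v]))"
  using assms
proof (induction p)
  case Nil
  then have "pair_bidirected_digraph (path_of [u, w, v])" by (intro path_of_bidirected) simp
  from subdivision_pair_base[OF this] show ?case by (simp only: append_Nil)
next
  case (Cons x p)
  then have IH: "subdivision_pair (path_of [u, w, v]) (path_of (u # p @ [w, v]))" by auto
  define q where "q = p @ [w, v]"
  have q: "q \<noteq> []" "distinct (u # x # q)" using Cons.prems by (auto simp: q_def)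
  have "u \<notin> set q" using q by simp
  then have "(u, hd q) \<notin> set (vwalk_arcs q)" "(hd q, u) \<notin> set (vwalk_arcs q)"
    by (auto dest: vwalk_arcs_in_set)
  then have "path_of (u # x # q) = subdivide (path_of (u # q)) (u, hd q) x"
    using q by (auto simp: path_of_def subdivide.simps symcl_def)
  moreover have "subdivision_pair (path_of [u, w, v]) (subdivide (path_of (u # q)) (u, hd q) x)"
    using IH q by (intro subdivision_pair_divide) (auto simp: q_def symcl_def)
  ultimately show ?case by (simp add: q_def)
qed

section \<open>Connectedness and branch sets of minors\<close>

lemma connected_with_proj_iff:
  assumes "pair_bidirected_digraph G"
  shows "Digraph_Component.connected (with_proj G) \<longleftrightarrow>
    pverts G \<noteq> {} \<and> (\<forall>x\<in>pverts G. \<forall>y\<in>pverts G. (x, y) \<in> (parcs G)\<^sup>*)"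
proof -
  interpret pair_bidirected_digraph G by fact
  have "x \<rightarrow>\<^sup>*\<^bsub>mk_symmetric G\<^esub> y \<longleftrightarrow> (x, y) \<in> (parcs G)\<^sup>*" if "x \<in> pverts G" for x y
    using reachable_mk_symmetric_eq[OF pair_sym_arcs] reachable_conv'[OF that] by simp
  then show ?thesis
    unfolding Digraph_Component.connected_def strongly_connected_def by simp
qed

lemma induce_subgraph_with_proj:
  "with_proj G \<restriction> A = with_proj \<lparr>pverts = A, parcs = Restr (parcs G) A\<rparr>"
  by (auto simp: induce_subgraph_def with_proj_def)

lemma connected_induce_iff:
  assumes "pair_bidirected_digraph G"
  shows "Digraph_Component.connected (with_proj G \<restriction> A) \<longleftrightarrow>
    A \<noteq> {} \<and> (\<forall>x\<in>A. \<forall>y\<in>A. (x, y) \<in> (Restr (parcs G) A)\<^sup>*)"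
proof -
  have "pair_bidirected_digraph \<lparr>pverts = A, parcs = Restr (parcs G) A\<rparr>"
    using assms by (auto simp: pair_bidirected_digraph_iff sym_def irrefl_def)
  then show ?thesis unfolding induce_subgraph_with_proj by (simp add: connected_with_proj_iff)
qed

lemma connected_induce_Un:
  assumes G: "pair_bidirected_digraph G"
    and A: "Digraph_Component.connected (with_proj G \<restriction> A)"
    and B: "Digraph_Component.connected (with_proj G \<restriction> B)"
    and ab: "a \<in> A" "b \<in> B" "(a, b) \<in> parcs G"
  shows "Digraph_Component.connected (with_proj G \<restriction> (A \<union> B))"
proof -
  let ?R = "(Restr (parcs G) (A \<union> B))\<^sup>*"
  have mono: "(Restr (parcs G) A)\<^sup>* \<subseteq> ?R" "(Restr (parcs G) B)\<^sup>* \<subseteq> ?R"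
    by (intro rtrancl_mono; blast)+
  have "sym ?R" using G by (intro sym_rtrancl) (auto simp: pair_bidirected_digraph_iff sym_def)
  have "(x, a) \<in> ?R" if "x \<in> A \<union> B" for x
  proof (cases "x \<in> A")
    case True
    then show ?thesis using A ab mono by (auto simp: connected_induce_iff[OF G])
  next
    case False
    then have "(x, b) \<in> ?R" using that B ab mono by (auto simp: connected_induce_iff[OF G])
    moreover have "(a, b) \<in> ?R" using ab by auto
    ultimately show ?thesis using \<open>sym ?R\<close> by (meson rtrancl_trans symD)
  qed
  then have "(x, y) \<in> ?R" if "x \<in> A \<union> B" "y \<in> A \<union> B" for x y
    using that \<open>sym ?R\<close> by (meson rtrancl_trans symD)
  then show ?thesis unfolding connected_induce_iff[OF G] using ab by blast
qed

text \<open>Contracting the edge from \<open>u\<close> to the new vertex \<open>w\<close> undoes the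
  subdivision: the branch set of \<open>w\<close> is merged into that of \<open>u\<close>.\<close>

lemma minor_subdivide:
  assumes G: "pair_bidirected_digraph G" and H: "pair_bidirected_digraph H"
    and e: "e \<in> parcs H" "w \<notin> pverts H" and m: "minor (subdivide H e w) G"
  shows "minor H G"
proof -
  obtain u v where uv: "e = (u, v)" by (cases e)
  then have u: "u \<in> pverts H" "v \<in> pverts H" "u \<noteq> v" "w \<noteq> u"
    using H e by (auto simp: pair_bidirected_digraph_iff irrefl_def)
  from m obtain \<beta> where \<beta>: 
    "\<forall>x\<in>pverts H \<union> {w}. \<beta> x \<subseteq> pverts G \<and> Digraph_Component.connected (with_proj G \<restriction> \<beta> x)"
    "\<forall>x\<in>pverts H \<union> {w}. \<forall>y\<in>pverts H \<union> {w}. x \<noteq> y \<longrightarrow> \<beta> x \<inter> \<beta> y = {}"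
    "\<forall>(x, y)\<in>parcs (subdivide H e w). \<exists>a\<in>\<beta> x. \<exists>b\<in>\<beta> y. (a, b) \<in> parcs G"
    unfolding minor_def verts_subdivide by (elim exE conjE)
  have \<beta>3: "\<exists>a\<in>\<beta> x. \<exists>b\<in>\<beta> y. (a, b) \<in> parcs G" if "(x, y) \<in> parcs (subdivide H e w)" for x y
    using bspec[OF \<beta>(3) that] by simp
  have \<beta>2: "\<beta> x \<inter> \<beta> y = {}" if "x \<in> pverts H \<union> {w}" "y \<in> pverts H \<union> {w}" "x \<noteq> y" for x y
    using \<beta>(2) that by blast
  define \<gamma> where "\<gamma> = \<beta>(u := \<beta> u \<union> \<beta> w)"
  obtain a b where ab: "a \<in> \<beta> u" "b \<in> \<beta> w" "(a, b) \<in> parcs G"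
    using \<beta>3[of u w] by (auto simp: uv)
  have "\<gamma> x \<subseteq> pverts G \<and> Digraph_Component.connected (with_proj G \<restriction> \<gamma> x)" if "x \<in> pverts H" for x
    using \<beta>(1) that connected_induce_Un[OF G _ _ ab] by (auto simp: \<gamma>_def)
  moreover have "\<gamma> x \<inter> \<gamma> y = {}" if "x \<in> pverts H" "y \<in> pverts H" "x \<noteq> y" for x y
    using \<beta>2[of x y] \<beta>2[of w y] \<beta>2[of x w] that e(2) by (auto simp: \<gamma>_def)
  moreover have "\<exists>a\<in>\<gamma> x. \<exists>b\<in>\<gamma> y. (a, b) \<in> parcs G" if "(x, y) \<in> parcs H" for x y
  proof -
    \<comment> \<open>The subdivision removed the edge between \<open>u\<close> and
      \<open>v\<close>; the edge between \<open>w\<close> and \<open>v\<close> stands in for it. All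
      other arcs are still present.\<close>
    have "\<exists>a\<in>\<beta> (if x = u \<and> y = v then w else x). \<exists>b\<in>\<beta> (if x = v \<and> y = u then w else y).
        (a, b) \<in> parcs G"
      using that u by (intro \<beta>3) (auto simp: uv)
    then show ?thesis using u by (auto simp: \<gamma>_def split: if_splits)
  qed
  ultimately show ?thesis unfolding minor_def by (intro exI[of _ \<gamma>]) auto
qed

lemma minor_subdivision:
  assumes "subdivision_pair X H" "pair_bidirected_digraph G" "minor H G"
  shows "minor X G"
  using assms
proof (induction rule: subdivision_pair_induct)
  case (divide e w H)
  have "pair_bidirected_digraph H" using divide.hyps(3) by (rule subdivision_pair_bidirected)
  then have "minor H G" using minor_subdivide[OF divide.prems(1) _ divide.hyps(1,2) divide.prems(2)] by blast
  then show ?case using divide.IH divide.prems(1) by blast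
qed

lemma minor_subgraph:
  assumes "pverts H \<subseteq> pverts G" "parcs H \<subseteq> parcs G" "pair_bidirected_digraph G"
  shows "minor H G"
proof -
  have "Digraph_Component.connected (with_proj G \<restriction> {x})" for x
    using assms(3) by (simp add: connected_induce_iff)
  then show ?thesis
    unfolding minor_def using assms(1,2) by (intro exI[of _ "\<lambda>x. {x}"]) auto
qed

text \<open>\<open>X\<close> already uses vertices of \<open>G\<close>, so the identity serves as
  the isomorphism.\<close>

lemma topological_minor_subdivision:
  assumes "subdivision_pair X H" "subgraph (with_proj H) (with_proj G)"
  shows "topological_minor X G"
proof -
  interpret pair_bidirected_digraph X using assms(1) by (rule subdivision_pair_bidirected)
  have "digraph_iso (with_proj X) (with_proj X)"
    unfolding digraph_iso_def
    by (intro exI[of _ "\<lparr>iso_verts = id, iso_arcs = id, iso_head = snd, iso_tail = fst\<rparr>"])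
      (auto simp: digraph_isomorphism_def app_iso_def, auto simp: with_proj_def intro: wf_digraph_axioms[unfolded with_proj_def])
  then show ?thesis unfolding topological_minor_def using assms by blast
qed

section \<open>Flowers and complete bipartite graphs\<close>

lemma cycle_graph_arcD:
  assumes "cycle_graph C" "(x, y) \<in> parcs C"
  shows "x \<in> pverts C" "y \<in> pverts C" "x \<noteq> y" "(y, x) \<in> parcs C"
  using cycle_graph_pair_graph[OF assms(1)] assms(2)
  by (auto simp: pair_graph_iff pair_bidirected_digraph_iff irrefl_def dest: symD)

lemma cycle_graph_bidirected: "cycle_graph C \<Longrightarrow> pair_bidirected_digraph C"
  using cycle_graph_pair_graph pair_graph_iff by blast

text \<open>An arc has two different ends while two petals share only \<open>v\<close>, so no arc of
  one petal has both ends on another. This one fact makes the petals both induced and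
  edge-disjoint.\<close>

lemma flower_cycles_Union:
  assumes "finite A" "card A = r" "\<And>a. a \<in> A \<Longrightarrow> cycle_graph (C a)"
    and meet: "\<And>a b. a \<in> A \<Longrightarrow> b \<in> A \<Longrightarrow> a \<noteq> b \<Longrightarrow> pverts (C a) \<inter> pverts (C b) = {v}"
  shows "flower_cycles r (graph_Union A C) (C ` A)"
proof -
  have no_arc: "a = b" if "a \<in> A" "b \<in> A" "(x, y) \<in> parcs (C a)" "x \<in> pverts (C b)" "y \<in> pverts (C b)"
    for a b x y
    using cycle_graph_arcD[OF assms(3)[OF that(1)] that(3)] meet[OF that(1,2)] that(4,5)
    by (metis IntI singletonD)
  \<comment> \<open>Equal petals for different indices would consist of \<open>v\<close> alone;
    injectivity yields the count \<open>r\<close>.\<close>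
  have inj: "inj_on C A"
  proof (rule inj_onI, rule ccontr)
    fix a b assume ab: "a \<in> A" "b \<in> A" "C a = C b" "a \<noteq> b"
    then have "pverts (C a) = {v}" using meet[of a b] by auto
    then show False using cycle_graph_card[OF assms(3)[OF ab(1)]] by simp
  qed
  have ind: "induced_subgraph (with_proj (C a)) (with_proj (graph_Union A C))" if "a \<in> A" for a
  proof (rule induced_subgraphI)
    show "subgraph (with_proj (C a)) (with_proj (graph_Union A C))"
      using that assms(3) cycle_graph_bidirected
      by (subst subgraph_with_proj_iff) (auto intro: pair_bidirected_graph_Union)
    show "arcs (with_proj (C a)) = {e \<in> arcs (with_proj (graph_Union A C)).
      tail (with_proj (graph_Union A C)) e \<in> verts (with_proj (C a)) \<and>
      head (with_proj (graph_Union A C)) e \<in> verts (with_proj (C a))}"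
    proof -
      have "(x, y) \<in> parcs (C a) \<longleftrightarrow>
          (\<exists>b\<in>A. (x, y) \<in> parcs (C b)) \<and> x \<in> pverts (C a) \<and> y \<in> pverts (C a)" for x y
        using that no_arc[OF _ that] cycle_graph_arcD(1,2)[OF assms(3)[OF that]] by metis
      then show ?thesis by auto
    qed
  qed
  have disj: "edges (C a) \<inter> edges (C b) = {}" if ab: "a \<in> A" "b \<in> A" "a \<noteq> b" for a b
  proof -
    have False if xy: "(x, y) \<in> parcs (C a)" "(x', y') \<in> parcs (C b)" "{x, y} = {x', y'}" for x y x' y'
      using no_arc[OF ab(1,2) xy(1)] cycle_graph_arcD[OF assms(3)[OF ab(2)] xy(2)] xy(3) ab(3) 
      by (metis doubleton_eq_iff)
    then show ?thesis unfolding edges_def by fastforce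
  qed
  show ?thesis
    unfolding flower_cycles_def
  proof (intro conjI exI[of _ v])
    show "\<forall>D\<in>C ` A. cycle_graph D \<and> induced_subgraph (with_proj D) (with_proj (graph_Union A C))"
      using assms(3) ind by blast
    show "\<forall>D\<in>C ` A. \<forall>D'\<in>C ` A. D \<noteq> D' \<longrightarrow> edges D \<inter> edges D' = {}" using disj by blast
    show "\<forall>D\<in>C ` A. \<forall>D'\<in>C ` A. D \<noteq> D' \<longrightarrow> pverts D \<inter> pverts D' = {v}" using meet by blast
  qed (use assms(1,2) inj in \<open>simp_all add: card_image\<close>)
qed

text \<open>\<open>u\<close> and \<open>v\<close> form one class, the last vertices of the fan paths
  the other. The latter are pairwise different because the paths share only
  \<open>u\<close>.\<close>

lemma K2_fan:
  assumes F: "fan (avoiding v E) u W F" "card F = r" "1 \<le> r" "u \<noteq> v"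
  defines "X \<equiv> \<lambda>p. path_of [u, last p, v]" and "H \<equiv> \<lambda>p. path_of (p @ [v])"
  shows "K\<^bsub>2,r\<^esub> (with_proj (graph_Union F X))"
    and "subdivision_pair (graph_Union F X) (graph_Union F H)"
proof -
  have fin: "finite F" using F by (simp add: fan_def)
  have F': "hd p = u" "last p \<noteq> u" "distinct p" "v \<notin> set p" "p \<noteq> []" "u \<in> set p" "last p \<in> set p"
    if "p \<in> F" for p
  proof -
    obtain w where w: "w \<in> W - {u}" "spath (avoiding v E) u p w"
      using F(1) \<open>p \<in> F\<close> unfolding fan_def by meson
    then show "hd p = u" "last p \<noteq> u" "distinct p" "p \<noteq> []" "u \<in> set p" "last p \<in> set p"
      by (auto simp: spath_def)
    have "b \<noteq> v" if "(u, b) \<in> (avoiding v E)\<^sup>*" for b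
      using that F(4) by (induction rule: rtrancl_induct) auto
    then show "v \<notin> set p" using spath_imp_rtrancl[OF w(2)] by blast
  qed
  have meet: "set p \<inter> set q = {u}" if "p \<in> F" "q \<in> F" "p \<noteq> q" for p q
    using F(1) that unfolding fan_def by meson
  have inj: "inj_on last F"
  proof (rule inj_onI, rule ccontr)
    fix p q assume pq: "p \<in> F" "q \<in> F" "last p = last q" "p \<noteq> q"
    have "last p \<in> set p \<inter> set q" using F'(7)[OF pq(1)] F'(7)[OF pq(2)] pq(3) by simp
    then show False using meet[OF pq(1,2,4)] F'(2)[OF pq(1)] by simp
  qed
  have "F \<noteq> {}" using F by auto
  have "pverts (graph_Union F X) = {u, v} \<union> last ` F" using \<open>F \<noteq> {}\<close> by (auto simp: X_def)
  moreover have "parcs (graph_Union F X) = {u, v} \<times> last ` F \<union> last ` F \<times> {u, v}"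
    by (auto simp: X_def symcl_def)
  moreover have "{u, v} \<inter> last ` F = {}" using F' by fastforce
  moreover have "card {u, v} = 2" "card (last ` F) = r" using F(2,4) inj by (auto simp: card_image)
  moreover have "finite (pverts (graph_Union F X))" using fin by (simp add: X_def)
  ultimately show "K\<^bsub>2,r\<^esub> (with_proj (graph_Union F X))"
    unfolding complete_bipartite_digraph_pair_def by blast
  show "subdivision_pair (graph_Union F X) (graph_Union F H)"
  proof (rule subdivision_pair_Union)
    fix p assume p: "p \<in> F"
    obtain m where m: "p = u # m @ [last p]"
    proof -
      obtain q where q: "p = u # q" using F'[OF p] by (cases p) auto
      then have "q \<noteq> []" using F'[OF p] by auto
      then show ?thesis using that[of "butlast q"] q by simp
    qed
    have "distinct (u # m @ [last p, v])" using F'[OF p] F(4) by (subst (asm) (1 4) m) auto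
    then have "subdivision_pair (X p) (path_of (u # m @ [last p, v]))"
      unfolding X_def by (rule path_of_shrink)
    moreover have "p @ [v] = u # m @ [last p, v]" by (subst m) simp
    ultimately show "subdivision_pair (X p) (H p)" unfolding H_def by (simp only:)
  next
    fix p q assume pq: "p \<in> F" "q \<in> F" "p \<noteq> q"
    then show "pverts (H p) \<inter> pverts (H q) \<subseteq> pverts (X p)"
      using meet by (auto simp: H_def X_def)
    have "last p \<noteq> last q" using inj pq by (auto dest: inj_onD)
    then show "parcs (X p) \<inter> parcs (X q) = {}"
      using F'[OF pq(1)] F'[OF pq(2)] F(4) by (auto simp: X_def symcl_def)
  qed (rule fin)
qed

section \<open>Blocks of a chain of cycles\<close>

lemma cutvertex_with_proj_iff:
  assumes "pair_bidirected_digraph B"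
  shows "cutvertex (with_proj B) v \<longleftrightarrow> v \<in> pverts B \<and> (\<exists>x\<in>pverts B - {v}. \<exists>y\<in>pverts B - {v}.
    (x, y) \<in> (parcs B)\<^sup>* \<and> (x, y) \<notin> (avoiding v (parcs B))\<^sup>*)"
proof -
  interpret pair_bidirected_digraph B by fact
  let ?D = "\<lparr>pverts = pverts B - {v}, parcs = avoiding v (parcs B)\<rparr>"
  have D: "pre_digraph.del_vert (with_proj B) v = with_proj ?D"
    by (auto simp: pre_digraph.del_vert_def with_proj_def)
  interpret D: pair_wf_digraph ?D
    using wellformed' by unfold_locales auto
  have "x \<rightarrow>\<^sup>*\<^bsub>with_proj ?D\<^esub> y \<longleftrightarrow> (x, y) \<in> (avoiding v (parcs B))\<^sup>*" if "x \<in> pverts B - {v}" for x y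
    using D.reachable_conv'[of x y] that by simp
  moreover have "x \<rightarrow>\<^sup>*\<^bsub>with_proj B\<^esub> y \<longleftrightarrow> (x, y) \<in> (parcs B)\<^sup>*" if "x \<in> pverts B" for x y
    using reachable_conv'[of x y] that by simp
  ultimately show ?thesis unfolding cutvertex_def D by auto
qed

lemma symcl_Un_converse: "symcl (A \<union> B\<inverse>) = symcl (A \<union> B)"
  by (auto simp: symcl_def)

lemma path_connected:
  assumes "x \<in> set ws" "y \<in> set ws"
  shows "(x, y) \<in> (symcl (set (vwalk_arcs ws)))\<^sup>*"
proof -
  let ?R = "symcl (set (vwalk_arcs ws))"
  have "(hd p, z) \<in> (symcl (set (vwalk_arcs p)))\<^sup>*" if "z \<in> set p" for z and p :: "'a list"
    using that
  proof (induction p)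
    case (Cons a p)
    show ?case
    proof (cases "z = a")
      case False
      then have z: "z \<in> set p" "p \<noteq> []" using Cons.prems by auto
      have "(symcl (set (vwalk_arcs p)))\<^sup>* \<subseteq> (symcl (set (vwalk_arcs (a # p))))\<^sup>*"
        using z by (intro rtrancl_mono) (auto simp: symcl_def)
      moreover have "(a, hd p) \<in> symcl (set (vwalk_arcs (a # p)))" using z by (auto simp: symcl_def)
      ultimately show ?thesis using Cons.IH[OF z(1)] by (simp add: converse_rtrancl_into_rtrancl subset_iff)
    qed simp
  qed simp
  then have "(hd ws, x) \<in> ?R\<^sup>*" "(hd ws, y) \<in> ?R\<^sup>*" using assms by auto
  then show ?thesis using sym_rtrancl[OF sym_symcl] by (meson rtrancl_trans symD)
qed

text \<open>A cycle without one of its vertices is a path, and a cycle not containing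
  \<open>v\<close> is still connected when opened at its closing edge. Hence cycles have no
  cutvertex.\<close>

lemma cycle_graph_connected_avoiding:
  assumes "cycle_graph C" "x \<in> pverts C - {v}" "y \<in> pverts C - {v}"
  shows "(x, y) \<in> (avoiding v (parcs C))\<^sup>*"
proof -
  obtain ws where ws: "set ws = pverts C - {v}" "set (vwalk_arcs ws) \<subseteq> parcs C"
  proof (cases "v \<in> pverts C")
    case True
    then obtain ws where "2 \<le> length ws" "distinct (v # ws)" "C = cycle_of (v # ws)"
      using cycle_graph_rotate assms(1) by metis
    moreover from this have "ws \<noteq> []" by auto
    ultimately show ?thesis
      using that[of ws] set_vwalk_arcs_append[of "[v]" ws] set_vwalk_arcs_append[of "v # ws" "[v]"]
      by (auto simp: symcl_def)
  next
    case False
    obtain vs where "3 \<le> length vs" "C = cycle_of vs"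
      using assms(1) unfolding cycle_graph_iff by blast
    moreover from this have "vs \<noteq> []" by auto
    ultimately show ?thesis using that[of vs] False by (auto simp: set_vwalk_arcs_append symcl_def)
  qed
  have "symcl (set (vwalk_arcs ws)) \<subseteq> avoiding v (parcs C)"
  proof -
    have "(a, b) \<in> avoiding v (parcs C)" if "(a, b) \<in> set (vwalk_arcs ws)" for a b
      using that ws vwalk_arcs_in_set[OF that] by auto
    then show ?thesis using cycle_graph_arcD(4)[OF assms(1)] by (fastforce simp: symcl_def)
  qed
  then show ?thesis using path_connected[of x ws y] assms ws rtrancl_mono by blast
qed

lemma cycle_graph_connected:
  assumes "cycle_graph C" "x \<in> pverts C" "y \<in> pverts C"
  shows "(x, y) \<in> (parcs C)\<^sup>*"
proof -
  have "card {x, y} \<le> 2" by (simp add: card_insert_if)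
  then have "\<not> pverts C \<subseteq> {x, y}"
    using cycle_graph_card[OF assms(1)] card_mono[of "{x, y}" "pverts C"] by auto
  then obtain v where "v \<noteq> x" "v \<noteq> y" by blast
  then have "(x, y) \<in> (avoiding v (parcs C))\<^sup>*"
    using assms by (intro cycle_graph_connected_avoiding) auto
  then show ?thesis by (rule rtrancl_mono[THEN subsetD, rotated]) auto
qed

text \<open>Indexed form of a chain, with \<open>c i\<close> linking the cycles \<open>i\<close> and
  \<open>i + 1\<close>. It is instantiated with the cycles found and again with the triangles to
  which they shrink.\<close>

locale cycle_chain =
  fixes n :: nat and C :: "nat \<Rightarrow> 'a pair_pre_digraph" and c :: "nat \<Rightarrow> 'a"
  assumes n_pos: "0 < n"
    and cycle: "i < n \<Longrightarrow> cycle_graph (C i)"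
    and link: "Suc i < n \<Longrightarrow> pverts (C i) \<inter> pverts (C (Suc i)) = {c i}"
    and far: "Suc i < j \<Longrightarrow> j < n \<Longrightarrow> pverts (C i) \<inter> pverts (C j) = {}"
begin

definition G :: "'a pair_pre_digraph" where "G = graph_Union {..<n} C"

text \<open>\<open>L i\<close> and \<open>R i\<close> are the two sides of the separation at
  \<open>c i\<close>; for \<open>Suc i < n\<close> this link belongs to both.\<close>

definition L :: "nat \<Rightarrow> 'a set" where "L i = (\<Union>j\<in>{..i}. pverts (C j))"

definition R :: "nat \<Rightarrow> 'a set" where "R i = (\<Union>j\<in>{i<..<n}. pverts (C j))"

lemma G_simps: "pverts G = (\<Union>i<n. pverts (C i))" "parcs G = (\<Union>i<n. parcs (C i))"
  by (simp_all add: G_def)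

lemma pair_graph_G: "pair_graph G"
  unfolding pair_graph_iff
proof
  show "finite (pverts G)"
    using cycle cycle_graph_pair_graph by (auto simp: G_simps pair_graph_iff)
  show "pair_bidirected_digraph G"
    unfolding G_def using cycle cycle_graph_bidirected by (intro pair_bidirected_graph_Union) auto
qed

lemma G_bidirected: "pair_bidirected_digraph G"
  using pair_graph_G by (simp add: pair_graph_iff)

lemma common_vertex:
  assumes "i < j" "j < n" "x \<in> pverts (C i)" "x \<in> pverts (C j)"
  shows "j = Suc i \<and> x = c i"
proof (cases "j = Suc i")
  case True
  then show ?thesis using link[of i] assms by auto
next
  case False
  then show ?thesis using far[of i j] assms by auto
qed

lemma common_vertices_eq:
  assumes "i \<noteq> j" "i < n" "j < n" "{x, y} \<subseteq> pverts (C i)" "{x, y} \<subseteq> pverts (C j)"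
  shows "x = y"
proof (cases "i < j")
  case True
  then show ?thesis using assms common_vertex[of i j x] common_vertex[of i j y] by auto
next
  case False
  then show ?thesis using assms common_vertex[of j i x] common_vertex[of j i y] by auto
qed

lemma link_in: "Suc i < n \<Longrightarrow> c i \<in> pverts (C i)" "Suc i < n \<Longrightarrow> c i \<in> pverts (C (Suc i))"
  using link by blast+

lemma link_in_iff:
  assumes "Suc i < n" "j < n"
  shows "c i \<in> pverts (C j) \<longleftrightarrow> j = i \<or> j = Suc i"
proof
  assume j: "c i \<in> pverts (C j)"
  show "j = i \<or> j = Suc i"
  proof (cases "j < i")
    case True
    then show ?thesis using common_vertex[of j "Suc i" "c i"] assms j link_in[of i] by auto
  next
    case False
    then show ?thesis using common_vertex[of i j "c i"] assms j link_in[of i] by (cases "i = j") auto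
  qed
qed (use assms link_in in auto)

lemma link_inj:
  assumes "Suc i < n" "Suc j < n" "c i = c j"
  shows "i = j"
  using link_in_iff[of i "Suc j"] link_in_iff[of j "Suc i"] link_in[of i] link_in[of j] assms by auto

lemma C_inj:
  assumes "i < n" "j < n" "pverts (C i) \<subseteq> pverts (C j)"
  shows "i = j"
proof (rule ccontr)
  assume "i \<noteq> j"
  have ne: "\<not> pverts (C i) \<subseteq> {x}" for x
    using cycle_graph_card[OF cycle[OF assms(1)]] card_mono[of "{x}" "pverts (C i)"] by auto
  then obtain x where "x \<in> pverts (C i)" by blast
  moreover obtain y where "y \<in> pverts (C i)" "y \<noteq> x" using ne[of x] by blast
  ultimately have "{x, y} \<subseteq> pverts (C i)" "x \<noteq> y" by auto
  then show False using common_vertices_eq[OF \<open>i \<noteq> j\<close>, of x y] assms by auto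
qed

lemma arc_in_cycle:
  assumes "(x, y) \<in> parcs G" "x \<in> pverts (C j)" "y \<in> pverts (C j)" "j < n"
  shows "(x, y) \<in> parcs (C j)"
proof -
  obtain i where i: "i < n" "(x, y) \<in> parcs (C i)" using assms by (auto simp: G_simps)
  note arc = cycle_graph_arcD[OF cycle[OF i(1)] i(2)]
  have "i = j" using common_vertices_eq[of i j x y] arc assms i by auto
  then show ?thesis using i by simp
qed

lemma L_Int_R:
  assumes "Suc i < n" "x \<in> L i" "x \<in> R i"
  shows "x = c i"
proof -
  obtain j k where "j \<le> i" "i < k" "k < n" "x \<in> pverts (C j)" "x \<in> pverts (C k)"
    using assms by (auto simp: L_def R_def)
  then show ?thesis using common_vertex[of j k x] by (metis le_antisym less_Suc_eq_le le_less_trans)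
qed

text \<open>An arc leaving \<open>L i\<close> would lie on a cycle of \<open>R i\<close>; its tail
  would then be on both sides and hence equal to \<open>c i\<close>.\<close>

lemma L_closed:
  assumes "(x, y) \<in> (avoiding (c i) (parcs G))\<^sup>*" "Suc i < n" "x \<in> L i"
  shows "y \<in> L i"
  using assms(1)
proof (induction rule: rtrancl_induct)
  case (step y z)
  then obtain j where j: "j < n" "(y, z) \<in> parcs (C j)" by (auto simp: G_simps)
  have yz: "y \<in> pverts (C j)" "z \<in> pverts (C j)" using cycle_graph_arcD[OF cycle[OF j(1)] j(2)] by auto
  have "y \<noteq> c i" using step by auto
  then have "y \<notin> R i" using L_Int_R[OF assms(2) step.IH] by blast
  then have "\<not> i < j" using yz j(1) unfolding R_def by fastforce
  then show ?case using yz by (auto simp: L_def)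
qed (use assms in simp)

text \<open>Vertices of \<open>B\<close> on both sides would be separated in \<open>B\<close> by
  \<open>c i\<close>, making it a cutvertex of \<open>B\<close>.\<close>

lemma separated_by_link:
  assumes B: "pverts B \<subseteq> pverts G" "parcs B \<subseteq> parcs G" "pair_bidirected_digraph B"
    and conn: "\<forall>x\<in>pverts B. \<forall>y\<in>pverts B. (x, y) \<in> (parcs B)\<^sup>*"
    and nocut: "\<not> cutvertex (with_proj B) (c i)" and i: "Suc i < n"
  shows "pverts B \<subseteq> L i \<or> pverts B \<subseteq> R i"
proof (rule ccontr)
  assume "\<not> ?thesis"
  then obtain p q where pq: "p \<in> pverts B" "p \<notin> R i" "q \<in> pverts B" "q \<notin> L i" by blast
  have LR: "x \<in> L i \<or> x \<in> R i" if "x \<in> pverts B" for x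
    using that B(1) by (fastforce simp: L_def R_def G_simps)
  have c: "c i \<in> L i" "c i \<in> R i" using link_in[OF i] i by (auto simp: L_def R_def)
  have "p \<in> L i" "p \<noteq> c i" "q \<noteq> c i" using pq LR c by auto
  have "(avoiding (c i) (parcs B))\<^sup>* \<subseteq> (avoiding (c i) (parcs G))\<^sup>*"
    using B(2) by (intro rtrancl_mono) auto
  then have nopath: "(p, q) \<notin> (avoiding (c i) (parcs B))\<^sup>*" using L_closed[OF _ i \<open>p \<in> L i\<close>] pq by blast
  have path: "(p, q) \<in> (parcs B)\<^sup>*" using conn pq by blast
  \<comment> \<open>Otherwise avoiding \<open>c i\<close> deletes no arc of \<open>B\<close>, and
    the two sides would be disconnected in \<open>B\<close> itself.\<close>
  have "c i \<in> pverts B"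
  proof (rule ccontr)
    assume "c i \<notin> pverts B"
    then have "avoiding (c i) (parcs B) = parcs B" using B(3) by (auto simp: pair_bidirected_digraph_iff)
    then show False using path nopath by simp
  qed
  then show False
    using nocut path nopath pq \<open>p \<noteq> c i\<close> \<open>q \<noteq> c i\<close> unfolding cutvertex_with_proj_iff[OF B(3)] by blast
qed

lemma block_like_in_cycle:
  assumes B: "pverts B \<subseteq> pverts G" "parcs B \<subseteq> parcs G" "pair_bidirected_digraph B"
    and conn: "\<forall>x\<in>pverts B. \<forall>y\<in>pverts B. (x, y) \<in> (parcs B)\<^sup>*"
    and nocut: "\<nexists>v. cutvertex (with_proj B) v"
  obtains j where "j < n" "pverts B \<subseteq> pverts (C j)" "parcs B \<subseteq> parcs (C j)"
proof -
  have "pverts G \<subseteq> L (n - 1)" using n_pos by (fastforce simp: G_simps L_def)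
  then have ex: "pverts B \<subseteq> L (n - 1)" using B(1) by blast
  \<comment> \<open>By minimality, for \<open>j > 0\<close>, \<open>B\<close> is not left of the
    link \<open>c (j - 1)\<close>, hence it is right of it; and \<open>L j\<close> and
    \<open>R (j - 1)\<close> have just the vertices of \<open>C j\<close> in common.\<close>
  define j where "j = (LEAST i. pverts B \<subseteq> L i)"
  have j: "pverts B \<subseteq> L j" using LeastI[of "\<lambda>i. pverts B \<subseteq> L i", OF ex] by (simp add: j_def)
  have "j \<le> n - 1" using Least_le[of "\<lambda>i. pverts B \<subseteq> L i", OF ex] by (simp add: j_def)
  then have "j < n" using n_pos by simp
  have sub: "pverts B \<subseteq> pverts (C j)"
  proof (cases j)
    case 0
    then show ?thesis using j by (simp add: L_def)
  next
    case (Suc k)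
    then have "\<not> pverts B \<subseteq> L k"
      using not_less_Least[of k "\<lambda>i. pverts B \<subseteq> L i"] by (simp add: j_def)
    then have "pverts B \<subseteq> R k" using separated_by_link[OF B conn, of k] nocut Suc \<open>j < n\<close> by auto
    show ?thesis
    proof
      fix x assume "x \<in> pverts B"
      then obtain a b where ab: "a \<le> j" "x \<in> pverts (C a)" "k < b" "b < n" "x \<in> pverts (C b)"
        using j \<open>pverts B \<subseteq> R k\<close> by (fastforce simp: L_def R_def)
      show "x \<in> pverts (C j)"
      proof (cases "a = j \<or> b = j")
        case False
        then have "a < j" "j < b" using ab Suc by auto
        then show ?thesis using common_vertex[of a b x] ab by simp
      qed (use ab in auto)
    qed
  qed
  moreover have "parcs B \<subseteq> parcs (C j)"
  proof
    fix e assume "e \<in> parcs B"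
    then obtain x y where "e = (x, y)" "x \<in> pverts B" "y \<in> pverts B" "(x, y) \<in> parcs G"
      using B by (cases e) (auto simp: pair_bidirected_digraph_iff)
    then show "e \<in> parcs (C j)" using arc_in_cycle[of x y j] sub \<open>j < n\<close> by blast
  qed
  ultimately show ?thesis using that \<open>j < n\<close> by blast
qed

lemma cycle_block_like:
  assumes "j < n"
  shows "graph (with_proj (C j))" "Digraph_Component.connected (with_proj (C j))"
    "\<nexists>v. cutvertex (with_proj (C j)) v" "subgraph (with_proj (C j)) (with_proj G)"
proof -
  note Cj = cycle[OF assms]
  interpret pair_graph "C j" using Cj by (rule cycle_graph_pair_graph)
  show "graph (with_proj (C j))" by (rule pair_graphD_graph)
  have "pverts (C j) \<noteq> {}" using cycle_graph_card[OF Cj] by auto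
  then show "Digraph_Component.connected (with_proj (C j))"
    using cycle_graph_connected[OF Cj] cycle_graph_bidirected[OF Cj] by (simp add: connected_with_proj_iff)
  show "\<nexists>v. cutvertex (with_proj (C j)) v"
    using cycle_graph_connected_avoiding[OF Cj] cycle_graph_bidirected[OF Cj]
    by (auto simp: cutvertex_with_proj_iff)
  show "subgraph (with_proj (C j)) (with_proj G)"
    using assms cycle_graph_bidirected[OF Cj] G_bidirected by (auto simp: subgraph_with_proj_iff G_simps)
qed

text \<open>Maximality of a block quantifies over arbitrary \<open>pre_digraph\<close> values; being
  a subgraph of \<open>G\<close> fixes tail and head, so each competitor comes from a
  \<open>pair_pre_digraph\<close>.\<close>

lemma block_like_with_proj:
  assumes "subgraph H (with_proj G)" "graph H" "Digraph_Component.connected H" "\<nexists>v. cutvertex H v"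
  obtains j where "j < n" "verts H \<subseteq> pverts (C j)" "arcs H \<subseteq> parcs (C j)"
proof -
  define B where "B = \<lparr>pverts = verts H, parcs = arcs H\<rparr>"
  have "tail H = fst" "head H = snd" using assms(1) by (auto simp: subgraph_def compatible_def)
  then have H: "H = with_proj B" by (simp add: B_def with_proj_def)
  have B: "pair_bidirected_digraph B"
    using pair_graphI_graph assms(2) unfolding H pair_graph_iff by blast
  have "pverts B \<subseteq> pverts G" "parcs B \<subseteq> parcs G"
    using assms(1) unfolding H subgraph_def by auto
  then show ?thesis
    using block_like_in_cycle[OF _ _ B] assms(3,4) that unfolding H connected_with_proj_iff[OF B]
    by auto
qed

text \<open>Every block candidate lies within one cycle, every cycle is itself a candidate, and by
  \<open>C_inj\<close> no cycle lies within another.\<close>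

lemma block_iff: "block G B \<longleftrightarrow> (\<exists>j<n. B = C j)"
proof
  assume "block G B"
  then have B: "subgraph (with_proj B) (with_proj G)" "graph (with_proj B)"
    "Digraph_Component.connected (with_proj B)" "\<nexists>v. cutvertex (with_proj B) v"
    and max: "\<And>H. H \<noteq> with_proj B \<Longrightarrow> subgraph (with_proj B) H \<Longrightarrow> subgraph H (with_proj G) \<Longrightarrow>
      graph H \<Longrightarrow> Digraph_Component.connected H \<Longrightarrow> \<nexists>v. cutvertex H v \<Longrightarrow> False"
    unfolding block_def pre_digraph.max_subgraph_def by auto
  obtain j where j: "j < n" "pverts B \<subseteq> pverts (C j)" "parcs B \<subseteq> parcs (C j)"
    using block_like_with_proj[OF B] by auto
  have "pair_bidirected_digraph B" using pair_graphI_graph B(2) unfolding pair_graph_iff by blast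
  then have "subgraph (with_proj B) (with_proj (C j))"
    using j cycle_graph_bidirected[OF cycle[OF j(1)]] by (simp add: subgraph_with_proj_iff)
  then have "with_proj (C j) = with_proj B" using max cycle_block_like[OF j(1)] by blast
  then show "\<exists>j<n. B = C j" using j by (auto simp: with_proj_def)
next
  assume "\<exists>j<n. B = C j"
  then obtain j where j: "j < n" "B = C j" by blast
  have "H = with_proj (C j)" if H: "subgraph (with_proj (C j)) H" "subgraph H (with_proj G)" "graph H"
    "Digraph_Component.connected H" "\<nexists>v. cutvertex H v" for H
  proof -
    obtain k where k: "k < n" "verts H \<subseteq> pverts (C k)" "arcs H \<subseteq> parcs (C k)"
      using block_like_with_proj[OF H(2-5)] .
    have sub: "pverts (C j) \<subseteq> verts H" "parcs (C j) \<subseteq> arcs H" "tail H = fst" "head H = snd"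
      using H(1) by (auto simp: subgraph_def compatible_def)
    then have "j = k" using C_inj j(1) k by blast
    then have "verts H = pverts (C j)" "arcs H = parcs (C j)" using k sub by auto
    then show ?thesis using sub(3,4) by (auto simp: with_proj_def)
  qed
  then show "block G B"
    unfolding block_def pre_digraph.max_subgraph_def j(2) using cycle_block_like[OF j(1)] by blast
qed

lemma cutvertex_iff: "cutvertex (with_proj G) v \<longleftrightarrow> (\<exists>i. Suc i < n \<and> v = c i)"
proof
  assume cut: "cutvertex (with_proj G) v"
  show "\<exists>i. Suc i < n \<and> v = c i"
  proof (rule ccontr)
    assume no: "\<nexists>i. Suc i < n \<and> v = c i"
    let ?R = "avoiding v (parcs G)"
    have "sym ?R" using G_bidirected by (auto simp: pair_bidirected_digraph_iff sym_def)
    have local: "(x, y) \<in> ?R\<^sup>*" if "j < n" "x \<in> pverts (C j) - {v}" "y \<in> pverts (C j) - {v}" for j x y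
    proof -
      have "(avoiding v (parcs (C j)))\<^sup>* \<subseteq> ?R\<^sup>*"
        using that(1) by (intro rtrancl_mono) (auto simp: G_simps)
      then show ?thesis using cycle_graph_connected_avoiding[OF cycle[OF that(1)] that(2,3)] by blast
    qed
    \<comment> \<open>The walk goes back link by link to \<open>C 0\<close>; it can avoid
      \<open>v\<close> because \<open>v\<close> is no link.\<close>
    have left: "(x, y) \<in> ?R\<^sup>*" if "j < n" "x \<in> pverts (C j) - {v}" "y \<in> pverts (C 0) - {v}" for j x y
      using that
    proof (induction j arbitrary: x)
      case 0
      then show ?case using local by blast
    next
      case (Suc j)
      then have "c j \<noteq> v" "Suc j < n" using no by auto
      then have "(x, c j) \<in> ?R\<^sup>*" "(c j, y) \<in> ?R\<^sup>*"
        using local[of "Suc j" x "c j"] Suc link_in[of j] by auto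
      then show ?case by (rule rtrancl_trans)
    qed
    obtain z where z: "z \<in> pverts (C 0) - {v}"
    proof -
      have "\<not> pverts (C 0) \<subseteq> {v}"
        using cycle_graph_card[OF cycle[OF n_pos]] card_mono[of "{v}" "pverts (C 0)"] by auto
      then show ?thesis using that by blast
    qed
    have "(x, y) \<in> ?R\<^sup>*" if "x \<in> pverts G - {v}" "y \<in> pverts G - {v}" for x y
    proof -
      have "(x, z) \<in> ?R\<^sup>*" "(y, z) \<in> ?R\<^sup>*" using left z that by (auto simp: G_simps)
      then show ?thesis using sym_rtrancl[OF \<open>sym ?R\<close>] by (meson rtrancl_trans symD)
    qed
    then show False using cut unfolding cutvertex_with_proj_iff[OF G_bidirected] by blast
  qed
next
  assume "\<exists>i. Suc i < n \<and> v = c i"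
  then obtain i where i: "Suc i < n" "v = c i" by blast
  have other: "\<exists>x. x \<in> pverts (C j) \<and> x \<noteq> v" if "j < n" for j
  proof (rule ccontr)
    assume "\<not> ?thesis"
    then have "pverts (C j) \<subseteq> {v}" by blast
    then show False
      using cycle_graph_card[OF cycle[OF that]] card_mono[of "{v}" "pverts (C j)"] by simp
  qed
  \<comment> \<open>One vertex on each side of the link: joined through \<open>c i\<close>,
    separated without it.\<close>
  obtain p q where p: "p \<in> pverts (C i)" "p \<noteq> v" and q: "q \<in> pverts (C (Suc i))" "q \<noteq> v"
    using other[of i] other[of "Suc i"] i by auto
  have in_G: "x \<in> pverts G" if "x \<in> pverts (C j)" "j < n" for x j using that by (auto simp: G_simps)
  have "p \<in> L i" "q \<in> R i" using p q i by (auto simp: L_def R_def)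
  then have "q \<notin> L i" using L_Int_R[OF i(1)] q i by blast
  then have "(p, q) \<notin> (avoiding v (parcs G))\<^sup>*" using L_closed[OF _ i(1) \<open>p \<in> L i\<close>] i by blast
  moreover have "(p, q) \<in> (parcs G)\<^sup>*"
  proof -
    have sub: "(parcs (C j))\<^sup>* \<subseteq> (parcs G)\<^sup>*" if "j < n" for j
      using that by (intro rtrancl_mono) (auto simp: G_simps)
    have "(p, c i) \<in> (parcs (C i))\<^sup>*" "(c i, q) \<in> (parcs (C (Suc i)))\<^sup>*"
      using cycle_graph_connected[OF cycle] p(1) q(1) link_in[OF i(1)] i(1) by auto
    then show ?thesis using sub[of i] sub[of "Suc i"] i by (meson Suc_lessD rtrancl_trans subsetD)
  qed
  ultimately show "cutvertex (with_proj G) v"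
    unfolding cutvertex_with_proj_iff[OF G_bidirected]
    using p q i in_G[of _ i] in_G[of _ "Suc i"] link_in[OF i(1)] by auto
qed

section \<open>The block-cutvertex tree as an explicit path\<close>

fun bc_path :: "nat \<Rightarrow> ('a pair_pre_digraph + 'a) list" where
  "bc_path 0 = [Inl (C 0)]"
| "bc_path (Suc k) = bc_path k @ [Inr (c k), Inl (C (Suc k))]"

lemma bc_path_props:
  "bc_path k \<noteq> []" "last (bc_path k) = Inl (C k)"
  "set (bc_path k) = Inl ` C ` {..k} \<union> Inr ` c ` {..<k}"
  by (induction k) (auto simp: atMost_Suc lessThan_Suc)

text \<open>The path alternates between blocks and cutvertices, so half of its arcs run against the
  orientation used in \<open>block_cutvertex_graph\<close>. The converse records this, and
  \<open>symcl\<close> later forgets it.\<close>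

lemma bc_path_arcs:
  "set (vwalk_arcs (bc_path k)) =
    (\<lambda>i. (Inl (C i), Inr (c i))) ` {..<k} \<union> ((\<lambda>i. (Inl (C (Suc i)), Inr (c i))) ` {..<k})\<inverse>"
  by (induction k) (auto simp: set_vwalk_arcs_append bc_path_props lessThan_Suc)

lemma bc_path_distinct: "k < n \<Longrightarrow> distinct (bc_path k)"
proof (induction k)
  case (Suc k)
  have "c k \<noteq> c i" if "i < k" for i using link_inj[of k i] Suc.prems that by auto
  then have "Inr (c k) \<notin> set (bc_path k)" by (auto simp: bc_path_props)
  moreover have "C (Suc k) \<noteq> C i" if "i \<le> k" for i using C_inj[of "Suc k" i] Suc.prems that by auto
  then have "Inl (C (Suc k)) \<notin> set (bc_path k)" by (auto simp: bc_path_props)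
  ultimately show ?case using Suc by auto
qed simp

lemma path_graph_block_cutvertex: "path_graph (block_cutvertex_graph G)"
proof -
  have lt: "{i. Suc i < n} = {..<n - 1}" "{..<n} = {..n - 1}" using n_pos by auto
  have "{B. block G B} = C ` {..n - 1}" "{v. cutvertex (with_proj G) v} = c ` {..<n - 1}"
    unfolding block_iff cutvertex_iff lt[symmetric] by auto
  then have "pverts (block_cutvertex_graph G) = set (bc_path (n - 1))"
    by (simp add: block_cutvertex_graph_def bc_path_props)
  moreover have "{(Inl B, Inr v) | B v. block G B \<and> cutvertex (with_proj G) v \<and> v \<in> pverts B} =
    (\<lambda>i. (Inl (C i), Inr (c i))) ` {..<n - 1} \<union> (\<lambda>i. (Inl (C (Suc i)), Inr (c i))) ` {..<n - 1}" (is "?A = ?B")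
  proof (intro set_eqI iffI)
    fix e assume "e \<in> ?A"
    then obtain i j where "j < n" "Suc i < n" "e = (Inl (C j), Inr (c i))" "c i \<in> pverts (C j)"
      by (auto simp: block_iff cutvertex_iff)
    then show "e \<in> ?B" using link_in_iff[of i j] by auto
  next
    fix e assume "e \<in> ?B"
    then obtain i where "i < n - 1" "e = (Inl (C i), Inr (c i)) \<or> e = (Inl (C (Suc i)), Inr (c i))"
      by auto
    moreover from this have "Suc i < n" by simp
    ultimately have "Suc i < n" "e = (Inl (C i), Inr (c i)) \<or> e = (Inl (C (Suc i)), Inr (c i))" by auto
    moreover have "block G (C i)" "block G (C (Suc i))" "cutvertex (with_proj G) (c i)"
      unfolding block_iff cutvertex_iff using \<open>Suc i < n\<close> Suc_lessD by blast+
    ultimately show "e \<in> ?A" using link_in[of i] by (elim disjE) auto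
  qed
  then have "parcs (block_cutvertex_graph G) = symcl (set (vwalk_arcs (bc_path (n - 1))))"
    unfolding block_cutvertex_graph_def bc_path_arcs symcl_Un_converse pair_pre_digraph.simps
    by (rule arg_cong)
  ultimately show ?thesis
    unfolding path_graph_def using bc_path_props(1) bc_path_distinct[of "n - 1"] n_pos
    by (intro exI[of _ "bc_path (n - 1)"]) auto
qed

lemma chain_of_blocks_G: "chain_of_blocks n G"
proof -
  have "{B. block G B} = C ` {..<n}" by (auto simp: block_iff)
  moreover have "inj_on C {..<n}" using C_inj by (auto intro!: inj_onI)
  ultimately have "card {B. block G B} = n" by (simp add: card_image)
  then show ?thesis
    unfolding chain_of_blocks_def using pair_graph_G path_graph_block_cutvertex by blast
qed

end

lemma (in cycle_chain) chain_of_cycles_G: "chain_of_cycles n G"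
  unfolding chain_of_cycles_def using chain_of_blocks_G cycle by (auto simp: block_iff)

lemma (in cycle_chain) chain_of_triangles_G:
  "(\<And>i. i < n \<Longrightarrow> triangle_graph (C i)) \<Longrightarrow> chain_of_triangles n G"
  unfolding chain_of_triangles_def using chain_of_blocks_G by (auto simp: block_iff)

lemma (in cycle_chain) triangle_chain:
  obtains T where "cycle_chain n T c" "\<And>i. i < n \<Longrightarrow> triangle_graph (T i)"
    "subdivision_pair (graph_Union {..<n} T) (graph_Union {..<n} C)"
proof -
  \<comment> \<open>The links on cycle \<open>i\<close>: two inside the chain, one at either end,
    none for \<open>n = 1\<close>. A triangle has room for them, so the triangles are linked by the
    same \<open>c\<close>.\<close>
  define S where "S i = (if Suc i < n then {c i} else {}) \<union> (if 0 < i then {c (i - 1)} else {})" for i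
  have "\<exists>T. cycle_graph T \<and> card (pverts T) = 3 \<and> S i \<subseteq> pverts T \<and> subdivision_pair T (C i)" if i: "i < n" for i
  proof (rule cycle_graph_shrink[OF cycle[OF i] order.refl cycle_graph_card[OF cycle[OF i]]])
    show "S i \<subseteq> pverts (C i)" using link_in[of i] link_in[of "i - 1"] i by (auto simp: S_def)
    show "card (S i) \<le> 3" by (simp add: S_def card_insert_if)
  qed
  then obtain T where T: "\<And>i. i < n \<Longrightarrow> cycle_graph (T i)" "\<And>i. i < n \<Longrightarrow> card (pverts (T i)) = 3"
    "\<And>i. i < n \<Longrightarrow> S i \<subseteq> pverts (T i)" "\<And>i. i < n \<Longrightarrow> subdivision_pair (T i) (C i)"
    by metis
  have sub: "pverts (T i) \<subseteq> pverts (C i)" if "i < n" for i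
    using subdivision_pair_preserves[OF T(4)[OF that]] by blast
  have in_T: "x \<in> pverts (T i)" "x \<in> pverts (T j)"
    if "i < j" "j < n" "x \<in> pverts (C i)" "x \<in> pverts (C j)" for i j x
    using common_vertex[OF that] T(3)[of i] T(3)[of j] that by (auto simp: S_def)
  have "cycle_chain n T c"
  proof
    fix i assume i: "Suc i < n"
    show "pverts (T i) \<inter> pverts (T (Suc i)) = {c i}"
      using link[OF i] sub[of i] sub[of "Suc i"] in_T[of i "Suc i" "c i"] i by auto
  next
    fix i j assume ij: "Suc i < j" "j < n"
    then show "pverts (T i) \<inter> pverts (T j) = {}" using far[OF ij] sub[of i] sub[of j] by auto
  qed (use n_pos T in auto)
  moreover have "subdivision_pair (graph_Union {..<n} T) (graph_Union {..<n} C)"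
  proof (rule subdivision_pair_Union)
    fix i j assume ij: "i \<in> {..<n}" "j \<in> {..<n}" "i \<noteq> j"
    then show "pverts (C i) \<inter> pverts (C j) \<subseteq> pverts (T i)"
      using in_T[of i j] in_T[of j i] by (cases "i < j") auto
    have False if "(x, y) \<in> parcs (T i)" "(x, y) \<in> parcs (T j)" for x y
      using common_vertices_eq[OF ij(3), of x y] cycle_graph_arcD(1-3)[OF T(1) that(1)]
        cycle_graph_arcD(1,2)[OF T(1) that(2)] sub[of i] sub[of j] ij by auto
    then show "parcs (T i) \<inter> parcs (T j) = {}" by auto
  qed (use T in auto)
  ultimately show ?thesis using that T(1,2) by (simp add: triangle_graph_def)
qed

section \<open>The unavoidable subgraphs\<close>

text \<open>The clause on \<open>y\<close> carries the induction: the end of a chain lies on its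
  head cycle alone, so a cycle attached there meets no other cycle.\<close>

lemma chain_intersections:
  assumes "chain E x Cs y"
  shows "(\<forall>i. Suc i < length Cs \<longrightarrow> (\<exists>z. set (Cs ! i) \<inter> set (Cs ! Suc i) = {z})) \<and>
    (\<forall>i j. Suc i < j \<and> j < length Cs \<longrightarrow> set (Cs ! i) \<inter> set (Cs ! j) = {}) \<and>
    (\<forall>i < length Cs. y \<in> set (Cs ! i) \<longleftrightarrow> i = 0) \<and> (\<forall>C\<in>set Cs. cyc E C)"
  using assms
proof (induction rule: chain.induct)
  case Nil
  then show ?case by simp
next
  case (Cons Cs c C y)
  have sub: "set (Cs ! i) \<subseteq> chain_verts x Cs" if "i < length Cs" for i
    using that by (auto simp: chain_verts_def)
  have meet: "set C \<inter> set (Cs ! i) = (if i = 0 then {c} else {})" if "i < length Cs" for i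
    using Cons.IH Cons.hyps(3) sub[OF that] that by auto
  have "\<exists>z. set ((C # Cs) ! i) \<inter> set ((C # Cs) ! Suc i) = {z}" if "Suc i < length (C # Cs)" for i
    using that meet[of 0] Cons.IH by (cases i) auto
  moreover have "set ((C # Cs) ! i) \<inter> set ((C # Cs) ! j) = {}" if "Suc i < j" "j < length (C # Cs)" for i j
    using that meet[of "j - 1"] Cons.IH by (cases i; cases j) auto
  moreover have "y \<in> set ((C # Cs) ! i) \<longleftrightarrow> i = 0" if "i < length (C # Cs)" for i
    using that Cons.hyps sub[of "i - 1"] by (cases i) auto
  moreover have "\<forall>D\<in>set (C # Cs). cyc E D" using Cons.IH Cons.hyps by auto
  ultimately show ?case by blast
qed

lemma cyc_cycle_graph: "cyc E vs \<Longrightarrow> cycle_graph (cycle_of vs)"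
  unfolding cyc_def cycle_graph_iff by blast

lemma chain_cycle_chain:
  assumes "chain E x Cs y" "Cs \<noteq> []"
  shows "\<exists>c. cycle_chain (length Cs) (\<lambda>i. cycle_of (Cs ! i)) c"
proof -
  note props = chain_intersections[OF assms(1)]
  then obtain c where "\<And>i. Suc i < length Cs \<Longrightarrow> set (Cs ! i) \<inter> set (Cs ! Suc i) = {c i}"
    by metis
  then have "cycle_chain (length Cs) (\<lambda>i. cycle_of (Cs ! i)) c"
    using props assms(2) by unfold_locales (auto intro: cyc_cycle_graph)
  then show ?thesis by blast
qed

lemma ex_vwalk_arc: "x \<in> set p \<Longrightarrow> \<exists>y. (x, y) \<in> set (vwalk_arcs (p @ [z]))"
proof (induction p)
  case (Cons a p)
  then show ?case by (cases "x = a") auto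
qed simp

text \<open>\<open>cyc\<close> speaks of arcs only; each vertex of a cycle is the tail of one of its
  arcs, which places it in \<open>G\<close>.\<close>

lemma cycle_of_subgraph:
  assumes "cyc (parcs G) vs" "pair_bidirected_digraph G"
  shows "pverts (cycle_of vs) \<subseteq> pverts G" "parcs (cycle_of vs) \<subseteq> parcs G"
proof -
  show "pverts (cycle_of vs) \<subseteq> pverts G"
  proof
    fix x assume "x \<in> pverts (cycle_of vs)"
    then obtain y where "(x, y) \<in> set (vwalk_arcs (vs @ [hd vs]))" using ex_vwalk_arc[of x vs] by auto
    then show "x \<in> pverts G" using assms by (auto simp: cyc_def pair_bidirected_digraph_iff)
  qed
  show "parcs (cycle_of vs) \<subseteq> parcs G"
    using assms by (simp add: cyc_def pair_bidirected_digraph_iff symcl_subset)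
qed

lemma path_of_subgraph:
  assumes "spath (parcs G) u p w" "(w, v) \<in> parcs G" "pair_bidirected_digraph G"
  shows "pverts (path_of (p @ [v])) \<subseteq> pverts G" "parcs (path_of (p @ [v])) \<subseteq> parcs G"
proof -
  have arcs: "set (vwalk_arcs (p @ [v])) \<subseteq> parcs G"
    using assms(1,2) by (auto simp: spath_def set_vwalk_arcs_append)
  show "pverts (path_of (p @ [v])) \<subseteq> pverts G"
  proof
    fix x assume "x \<in> pverts (path_of (p @ [v]))"
    then consider "x = v" | y where "(x, y) \<in> set (vwalk_arcs (p @ [v]))" using ex_vwalk_arc[of x p v] by auto
    then show "x \<in> pverts G" using assms arcs by cases (auto simp: pair_bidirected_digraph_iff)
  qed
  show "parcs (path_of (p @ [v])) \<subseteq> parcs G"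
    using arcs assms(3) by (simp add: pair_bidirected_digraph_iff symcl_subset)
qed

text \<open>Deleting no edge gives connectedness, deleting a single edge gives
  bridgelessness.\<close>

lemma edge_connected_2D:
  assumes "edge_connected 2 G"
  shows "pair_graph G" "bridgeless (parcs G)"
    "\<forall>x\<in>pverts G. \<forall>y\<in>pverts G. (x, y) \<in> (parcs G)\<^sup>*"
proof -
  have conn: "Digraph_Component.connected (with_proj (del_edges G F))" if "F \<subseteq> edges G" "card F < 2" for F
    using assms that unfolding edge_connected_def by blast
  show pg: "pair_graph G" using assms unfolding edge_connected_def by blast
  then have G: "pair_bidirected_digraph G" by (simp add: pair_graph_iff)
  have del: "pair_bidirected_digraph (del_edges G F)" for F
    using G by (auto simp: pair_bidirected_digraph_iff del_edges_def sym_def irrefl_def insert_commute)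
  have reach: "(x, y) \<in> {(u, v) \<in> parcs G. {u, v} \<notin> F}\<^sup>*"
    if "F \<subseteq> edges G" "card F < 2" "x \<in> pverts G" "y \<in> pverts G" for F x y
    using conn[OF that(1,2)] that(3,4) unfolding connected_with_proj_iff[OF del] by (simp add: del_edges_def)
  show "\<forall>x\<in>pverts G. \<forall>y\<in>pverts G. (x, y) \<in> (parcs G)\<^sup>*"
    using reach[of "{}"] by simp
  show "bridgeless (parcs G)"
    unfolding bridgeless_def
  proof clarify
    fix a b assume ab: "(a, b) \<in> parcs G"
    then have "a \<in> pverts G" "b \<in> pverts G" "{{a, b}} \<subseteq> edges G"
      using G by (auto simp: pair_bidirected_digraph_iff edges_def)
    then have "(a, b) \<in> {(u, v) \<in> parcs G. {u, v} \<notin> {{a, b}}}\<^sup>*" by (intro reach) auto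
    moreover have "{(u, v) \<in> parcs G. {u, v} \<notin> {{a, b}}} = parcs G - {(a, b), (b, a)}"
      by (auto simp: doubleton_eq_iff)
    ultimately show "(a, b) \<in> (parcs G - {(a, b), (b, a)})\<^sup>*" by simp
  qed
qed

lemma subdivision_in_graph:
  assumes "subdivision_pair X H" "pverts H \<subseteq> pverts G" "parcs H \<subseteq> parcs G" "pair_bidirected_digraph G"
  shows "subgraph (with_proj H) (with_proj G)" "topological_minor X G" "minor X G"
proof -
  show sub: "subgraph (with_proj H) (with_proj G)"
    using assms subdivision_pair_bidirected(2)[OF assms(1)] by (simp add: subgraph_with_proj_iff)
  show "topological_minor X G" using assms(1) sub by (rule topological_minor_subdivision)
  show "minor X G" using minor_subdivision[OF assms(1,4)] minor_subgraph[OF assms(2-4)] by blast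
qed

text \<open>The petals shrink independently; as every triangle retains \<open>v\<close>, they still
  meet pairwise in exactly \<open>v\<close>.\<close>

lemma flower_and_triangular_flower:
  assumes "finite A" "card A = r" "\<And>a. a \<in> A \<Longrightarrow> cycle_graph (C a) \<and> v \<in> pverts (C a)"
    and meet: "\<And>a b. a \<in> A \<Longrightarrow> b \<in> A \<Longrightarrow> a \<noteq> b \<Longrightarrow> pverts (C a) \<inter> pverts (C b) = {v}"
  obtains X where "flower r (graph_Union A C)" "triangular_flower r X" "subdivision_pair X (graph_Union A C)"
proof -
  have "\<exists>T. cycle_graph T \<and> card (pverts T) = 3 \<and> {v} \<subseteq> pverts T \<and> subdivision_pair T (C a)" if "a \<in> A" for a
    using assms(3)[OF that] cycle_graph_card by (intro cycle_graph_shrink) auto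
  then obtain T where T: "\<And>a. a \<in> A \<Longrightarrow> cycle_graph (T a)" "\<And>a. a \<in> A \<Longrightarrow> card (pverts (T a)) = 3"
    "\<And>a. a \<in> A \<Longrightarrow> v \<in> pverts (T a)" "\<And>a. a \<in> A \<Longrightarrow> subdivision_pair (T a) (C a)"
    by (metis insert_subset)
  have sub: "pverts (T a) \<subseteq> pverts (C a)" if "a \<in> A" for a
    using subdivision_pair_preserves[OF T(4)[OF that]] by blast
  have meetT: "pverts (T a) \<inter> pverts (T b) = {v}" if "a \<in> A" "b \<in> A" "a \<noteq> b" for a b
    using meet[OF that] sub[of a] sub[of b] T(3) that by blast
  have "flower_cycles r (graph_Union A C) (C ` A)"
    using assms by (intro flower_cycles_Union) auto
  moreover have "flower_cycles r (graph_Union A T) (T ` A)"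
    using assms T(1) meetT by (intro flower_cycles_Union) auto
  moreover have "subdivision_pair (graph_Union A T) (graph_Union A C)"
  proof (rule subdivision_pair_Union)
    fix a b assume ab: "a \<in> A" "b \<in> A" "a \<noteq> b"
    then show "pverts (C a) \<inter> pverts (C b) \<subseteq> pverts (T a)" using meet T(3) by auto
    have False if "(x, y) \<in> parcs (T a)" "(x, y) \<in> parcs (T b)" for x y
      using cycle_graph_arcD(1-3)[OF T(1)[OF ab(1)] that(1)] cycle_graph_arcD(1,2)[OF T(1)[OF ab(2)] that(2)]
        meetT[OF ab] by (metis IntI singletonD)
    then show "parcs (T a) \<inter> parcs (T b) = {}" by auto
  qed (use assms T in auto)
  ultimately show ?thesis
    using that[of "graph_Union A T"] T(1,2)
    unfolding flower_def triangular_flower_def triangle_graph_def by blast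
qed

theorem theorem4p1:
  fixes r :: nat
  assumes "r \<ge> 3"
  shows "\<exists>f :: nat. \<forall>G :: 'a pair_pre_digraph.
    edge_connected 2 G \<and> card (pverts G) \<ge> f \<longrightarrow>
      (\<exists>H :: 'a pair_pre_digraph. subgraph (with_proj H) (with_proj G) \<and>
         (flower r H \<or> (cycle_graph H \<and> card (pverts H) \<ge> r) \<or>
          chain_of_cycles r H \<or> K2_subdivision r H)) \<and>
      (\<exists>X :: 'a pair_pre_digraph. topological_minor X G \<and> minor X G \<and>
         (triangular_flower r X \<or> (cycle_graph X \<and> card (pverts X) = r) \<or>
          chain_of_triangles r X \<or> K\<^bsub>2,r\<^esub> (with_proj X)))"
proof (rule unavoidable_configuration[where 'a = 'a and r = r])
  show "1 \<le> r" using assms by simp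
next
  fix f
  assume f: "\<And>(V :: 'a set) E. finite V \<Longrightarrow> E \<subseteq> V \<times> V \<Longrightarrow> sym E \<Longrightarrow> irrefl E \<Longrightarrow>
    bridgeless E \<Longrightarrow> \<forall>x\<in>V. \<forall>y\<in>V. (x, y) \<in> E\<^sup>* \<Longrightarrow> f \<le> card V \<Longrightarrow> unavoidable r E"
  show ?thesis
  proof (rule exI[of _ f], intro allI impI)
    fix G :: "'a pair_pre_digraph"
    assume *: "edge_connected 2 G \<and> f \<le> card (pverts G)"
    let ?E = "parcs G"
    have "edge_connected 2 G" using * by blast
    note ec = edge_connected_2D[OF this]
    have G: "pair_bidirected_digraph G" and fin: "finite (pverts G)" using ec(1) by (auto simp: pair_graph_iff)
    have E: "?E \<subseteq> pverts G \<times> pverts G" "sym ?E" "irrefl ?E"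
      using G by (auto simp: pair_bidirected_digraph_iff)
    have "unavoidable r ?E" using f[OF fin E ec(2,3)] * by blast
    \<comment> \<open>One pair serves both claims: \<open>H\<close> is the subgraph of (a) and
      \<open>X\<close> the topological minor of (b). The last case records only \<open>X\<close>,
      since \<open>H\<close> is then a subdivision of K_{2,r} by definition.\<close>
    then have "\<exists>X H. subdivision_pair X H \<and> pverts H \<subseteq> pverts G \<and> parcs H \<subseteq> parcs G \<and>
      (flower r H \<and> triangular_flower r X \<or>
       cycle_graph H \<and> r \<le> card (pverts H) \<and> cycle_graph X \<and> card (pverts X) = r \<or>
       chain_of_cycles r H \<and> chain_of_triangles r X \<or> K\<^bsub>2,r\<^esub> (with_proj X))"
      unfolding unavoidable_def
    proof (elim disjE exE conjE)
      fix vs assume vs: "cyc ?E vs" "r \<le> length vs"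
      have C: "cycle_graph (cycle_of vs)" using vs(1) by (rule cyc_cycle_graph)
      moreover have card: "r \<le> card (pverts (cycle_of vs))"
        using vs by (auto simp: cyc_def distinct_card)
      \<comment> \<open>Nothing is glued to this cycle, hence the empty set of vertices to
        keep.\<close>
      ultimately obtain X where "cycle_graph X" "card (pverts X) = r" "subdivision_pair X (cycle_of vs)"
        using cycle_graph_shrink[of "cycle_of vs" r "{}"] assms by auto
      then show ?thesis using C card cycle_of_subgraph[OF vs(1) G] by blast
    next
      fix x Cs y assume Cs: "chain ?E x Cs y" "length Cs = r"
      then have "Cs \<noteq> []" using assms by auto
      then obtain c where "cycle_chain r (\<lambda>i. cycle_of (Cs ! i)) c"
        using chain_cycle_chain[OF Cs(1)] Cs(2) by blast
      then interpret C: cycle_chain r "\<lambda>i. cycle_of (Cs ! i)" c .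
      obtain T where T: "cycle_chain r T c" "\<And>i. i < r \<Longrightarrow> triangle_graph (T i)"
        "subdivision_pair (graph_Union {..<r} T) C.G"
        using C.triangle_chain unfolding C.G_def by blast
      interpret T: cycle_chain r T c by (rule T(1))
      have "cyc ?E (Cs ! i)" if "i < r" for i
        using chain_intersections[OF Cs(1)] Cs(2) that by simp
      then have "pverts C.G \<subseteq> pverts G" "parcs C.G \<subseteq> ?E"
        using cycle_of_subgraph[OF _ G] unfolding C.G_simps by blast+
      moreover have "chain_of_triangles r (graph_Union {..<r} T)"
        using T.chain_of_triangles_G T(2) unfolding T.G_def by blast
      ultimately show ?thesis using C.chain_of_cycles_G T(3) by blast
    next
      fix v c and A :: "'a set"
      assume A: "finite A" "card A = r" "\<forall>a\<in>A. cyc ?E (c a) \<and> v \<in> set (c a)"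
        "\<forall>a\<in>A. \<forall>b\<in>A. a \<noteq> b \<longrightarrow> set (c a) \<inter> set (c b) = {v}"
      have petal: "cycle_graph (cycle_of (c a))" if "a \<in> A" for a
        using A(3) that cyc_cycle_graph by blast
      obtain X where "flower r (graph_Union A (\<lambda>a. cycle_of (c a)))" "triangular_flower r X"
        "subdivision_pair X (graph_Union A (\<lambda>a. cycle_of (c a)))"
        by (rule flower_and_triangular_flower[of A r "\<lambda>a. cycle_of (c a)" v])
          (use A petal in auto)
      moreover have "pverts (graph_Union A (\<lambda>a. cycle_of (c a))) \<subseteq> pverts G"
        "parcs (graph_Union A (\<lambda>a. cycle_of (c a))) \<subseteq> ?E"
        unfolding graph_Union_simps using cycle_of_subgraph[OF _ G] A(3) by blast+
      ultimately show ?thesis by blast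
    next
      fix u v F assume F: "fan (avoiding v ?E) u {w. (v, w) \<in> ?E} F" "card F = r" "u \<noteq> v"
      have "1 \<le> r" using assms by simp
      note K2 = K2_fan[OF F(1,2) this F(3)]
      have "pverts (path_of (p @ [v])) \<subseteq> pverts G \<and> parcs (path_of (p @ [v])) \<subseteq> ?E" if "p \<in> F" for p
      proof -
        obtain w where w: "(v, w) \<in> ?E" "spath (avoiding v ?E) u p w"
          using F(1) \<open>p \<in> F\<close> unfolding fan_def by blast
        have "spath ?E u p w" using w(2) by (rule spath_mono) auto
        moreover have "(w, v) \<in> ?E" using w(1) E(2) by (auto dest: symD)
        ultimately show ?thesis using path_of_subgraph[OF _ _ G] by simp
      qed
      then have "pverts (graph_Union F (\<lambda>p. path_of (p @ [v]))) \<subseteq> pverts G"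
        "parcs (graph_Union F (\<lambda>p. path_of (p @ [v]))) \<subseteq> ?E"
        unfolding graph_Union_simps by blast+
      then show ?thesis using K2 by blast
    qed
    then obtain X H where XH: "subdivision_pair X H" "pverts H \<subseteq> pverts G" "parcs H \<subseteq> parcs G"
      and or: "flower r H \<and> triangular_flower r X \<or>
       cycle_graph H \<and> r \<le> card (pverts H) \<and> cycle_graph X \<and> card (pverts X) = r \<or>
       chain_of_cycles r H \<and> chain_of_triangles r X \<or> K\<^bsub>2,r\<^esub> (with_proj X)"
      by blast
    have "K2_subdivision r H" if "K\<^bsub>2,r\<^esub> (with_proj X)"
      unfolding K2_subdivision_def using that XH(1) by blast
    then show "(\<exists>H :: 'a pair_pre_digraph. subgraph (with_proj H) (with_proj G) \<and>
         (flower r H \<or> (cycle_graph H \<and> card (pverts H) \<ge> r) \<or>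
          chain_of_cycles r H \<or> K2_subdivision r H)) \<and>
      (\<exists>X :: 'a pair_pre_digraph. topological_minor X G \<and> minor X G \<and>
         (triangular_flower r X \<or> (cycle_graph X \<and> card (pverts X) = r) \<or>
          chain_of_triangles r X \<or> K\<^bsub>2,r\<^esub> (with_proj X)))"
      using subdivision_in_graph[OF XH G] or by blast
  qed
qed

end
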